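(* Let $M$ be a connected, compact Riemannian manifold and let $f:M\to\mathbb{R}$ be a Morse function. Then any two critical points $p,q$ of $f$ can be connected by multiple orbits of the negative gradient flow of $f$. Precisely, there exists a finite sequence of critical points $p_1,\dots,p_n$ of $f$ with $p_1=p$ and $p_n=q$ such that, for each $1\le i\le n-1$, either $p_i$ flows to $p_{i+1}$ or $p_{i+1}$ flows to $p_i$.
   Context: Manifolds are smooth and without boundary. A Morse function on $M$ is a smooth function $f:M\to\mathbb{R}$ all of whose critical points are non-degenerate (the Hessian of $f$ at each critical point is non-degenerate). The gradient $\nabla f$ is taken with respect to the Riemannian metric of $M$. The negative gradient flow is the map $\Phi:M\times\mathbb{R}\to M$ with $\frac{\partial}{\partial t}\Phi(x,t)=-\nabla f(\Phi(x,t))$ and $\Phi(x,0)=x$; write $\phi_t=\Phi(\cdot,t)$. For critical points $a,b$ of $f$, "$a$ flows to $b$" means that there is a non-critical point $x\in M$ whose orbit satisfies $\lim_{t\to-\infty}\phi_t(x)=a$ and $\lim_{t\to+\infty}\phi_t(x)=b$. *)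

theory Defs
  imports "HOL-Analysis.Analysis"
begin

text \<open>
  Manifolds are modelled on a finite-dimensional inner product space. The class
  \<open>euclidean_space\<close> would exclude manifolds of dimension zero; the following class does not.
\<close>

class finite_dim_inner = real_inner +
  assumes finite_dim: "\<exists>B :: 'a set. finite B \<and> (\<forall>x. \<exists>r. x = (\<Sum>b\<in>B. r b *\<^sub>R b))"

instance euclidean_space \<subseteq> finite_dim_inner
  by standard (metis finite_Basis euclidean_representation)


subsection \<open>Smooth maps between open subsets of vector spaces\<close>

text \<open>
  \<open>Ck_on k F S\<close>, meant for open \<open>S\<close>: \<open>F\<close> is \<open>k\<close> times continuously differentiable on \<open>S\<close>.
  In finite dimension it suffices to ask that every directional derivative be \<open>k - 1\<close> times
  continuously differentiable.
\<close>

primrec Ck_on :: "nat \<Rightarrow> ('e::real_normed_vector \<Rightarrow> 'b::real_normed_vector) \<Rightarrow> 'e set \<Rightarrow> bool" where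
  "Ck_on 0 F S \<longleftrightarrow> continuous_on S F"
| "Ck_on (Suc k) F S \<longleftrightarrow>
     (\<forall>x\<in>S. F differentiable (at x)) \<and> (\<forall>v. Ck_on k (\<lambda>x. frechet_derivative F (at x) v) S)"

definition smooth_on :: "('e::real_normed_vector \<Rightarrow> 'b::real_normed_vector) \<Rightarrow> 'e set \<Rightarrow> bool" where
  "smooth_on F S \<longleftrightarrow> (\<forall>k. Ck_on k F S)"


subsection \<open>Smooth manifolds\<close>

text \<open>
  The manifold is a whole type \<open>'a\<close>. A chart is a pair of a domain \<open>U\<close> and a map, whose values
  outside \<open>U\<close> are irrelevant.
\<close>

type_synonym ('a, 'e) chart = "'a set \<times> ('a \<Rightarrow> 'e)"

definition chart_inv :: "('a, 'e) chart \<Rightarrow> 'e \<Rightarrow> 'a" where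
  "chart_inv c = inv_into (fst c) (snd c)"

definition is_chart :: "('a::topological_space, 'e::finite_dim_inner) chart \<Rightarrow> bool" where
  "is_chart c \<longleftrightarrow> open (fst c) \<and> open (snd c ` fst c) \<and>
     homeomorphism (fst c) (snd c ` fst c) (snd c) (chart_inv c)"

definition smooth_atlas :: "('a::topological_space, 'e::finite_dim_inner) chart set \<Rightarrow> bool" where
  "smooth_atlas A \<longleftrightarrow> (\<forall>c\<in>A. is_chart c) \<and> (\<Union>c\<in>A. fst c) = UNIV \<and>
     (\<forall>c\<in>A. \<forall>d\<in>A. smooth_on (snd d \<circ> chart_inv c) (snd c ` (fst c \<inter> fst d)))"

definition smooth_function ::
  "('a::topological_space, 'e::finite_dim_inner) chart set \<Rightarrow> ('a \<Rightarrow> real) \<Rightarrow> bool" where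
  "smooth_function A f \<longleftrightarrow> (\<forall>c\<in>A. smooth_on (f \<circ> chart_inv c) (snd c ` fst c))"


subsection \<open>Tangent vectors\<close>

text \<open>
  A tangent vector at \<open>p\<close> is the family of its coordinate vectors in all charts around \<open>p\<close>,
  related by the derivatives of the coordinate changes. It is set to zero at charts not
  containing \<open>p\<close>, so that equality of tangent vectors is equality of functions.
\<close>

type_synonym ('a, 'e) tvec = "('a, 'e) chart \<Rightarrow> 'e"

definition tangent_space ::
  "('a::topological_space, 'e::finite_dim_inner) chart set \<Rightarrow> 'a \<Rightarrow> ('a, 'e) tvec set" where
  "tangent_space A p = {v.
     (\<forall>c. \<not> (c \<in> A \<and> p \<in> fst c) \<longrightarrow> v c = 0) \<and>
     (\<forall>c\<in>A. \<forall>d\<in>A. p \<in> fst c \<and> p \<in> fst d \<longrightarrow>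
        v d = frechet_derivative (snd d \<circ> chart_inv c) (at (snd c p)) (v c))}"

text \<open>\<open>coord_vector A c p e\<close> is the tangent vector at \<open>p\<close> whose component in the chart \<open>c\<close> is \<open>e\<close>.\<close>

definition coord_vector ::
  "('a::topological_space, 'e::finite_dim_inner) chart set \<Rightarrow> ('a, 'e) chart \<Rightarrow> 'a \<Rightarrow> 'e \<Rightarrow> ('a, 'e) tvec" where
  "coord_vector A c p e = (\<lambda>d. if d \<in> A \<and> p \<in> fst d
     then frechet_derivative (snd d \<circ> chart_inv c) (at (snd c p)) e else 0)"

definition has_velocity ::
  "('a::topological_space, 'e::finite_dim_inner) chart set \<Rightarrow> (real \<Rightarrow> 'a) \<Rightarrow> ('a, 'e) tvec \<Rightarrow> real \<Rightarrow> bool" where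
  "has_velocity A \<gamma> v t \<longleftrightarrow> v \<in> tangent_space A (\<gamma> t) \<and> isCont \<gamma> t \<and>
     (\<forall>c\<in>A. \<gamma> t \<in> fst c \<longrightarrow> ((snd c \<circ> \<gamma>) has_vector_derivative v c) (at t))"

text \<open>For smooth \<open>f\<close> the number below does not depend on the chart, by the chain rule.\<close>

definition differential ::
  "('a::topological_space, 'e::finite_dim_inner) chart set \<Rightarrow> ('a \<Rightarrow> real) \<Rightarrow> 'a \<Rightarrow> ('a, 'e) tvec \<Rightarrow> real" where
  "differential A f p v = (THE r. \<forall>c\<in>A. p \<in> fst c \<longrightarrow>
     r = frechet_derivative (f \<circ> chart_inv c) (at (snd c p)) (v c))"


subsection \<open>Riemannian metrics and gradients\<close>

text \<open>Smoothness of the metric: its components in every chart are smooth functions.\<close>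

definition riemannian_metric ::
  "('a::topological_space, 'e::finite_dim_inner) chart set \<Rightarrow>
   ('a \<Rightarrow> ('a, 'e) tvec \<Rightarrow> ('a, 'e) tvec \<Rightarrow> real) \<Rightarrow> bool" where
  "riemannian_metric A g \<longleftrightarrow>
     (\<forall>p. \<forall>u\<in>tangent_space A p. \<forall>v\<in>tangent_space A p. \<forall>w\<in>tangent_space A p. \<forall>r.
        g p (\<lambda>c. r *\<^sub>R u c + v c) w = r * g p u w + g p v w) \<and>
     (\<forall>p. \<forall>u\<in>tangent_space A p. \<forall>v\<in>tangent_space A p. g p u v = g p v u) \<and>
     (\<forall>p. \<forall>u\<in>tangent_space A p. u \<noteq> (\<lambda>c. 0) \<longrightarrow> g p u u > 0) \<and>
     (\<forall>c\<in>A. \<forall>e e'. smooth_on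
        (\<lambda>y. g (chart_inv c y) (coord_vector A c (chart_inv c y) e) (coord_vector A c (chart_inv c y) e'))
        (snd c ` fst c))"

definition gradient ::
  "('a::topological_space, 'e::finite_dim_inner) chart set \<Rightarrow>
   ('a \<Rightarrow> ('a, 'e) tvec \<Rightarrow> ('a, 'e) tvec \<Rightarrow> real) \<Rightarrow> ('a \<Rightarrow> real) \<Rightarrow> 'a \<Rightarrow> ('a, 'e) tvec" where
  "gradient A g f p = (THE u. u \<in> tangent_space A p \<and>
     (\<forall>w\<in>tangent_space A p. g p u w = differential A f p w))"


subsection \<open>Morse functions\<close>

definition critical_point ::
  "('a::topological_space, 'e::finite_dim_inner) chart set \<Rightarrow> ('a \<Rightarrow> real) \<Rightarrow> 'a \<Rightarrow> bool" where
  "critical_point A f p \<longleftrightarrow> (\<forall>v\<in>tangent_space A p. differential A f p v = 0)"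

definition coord_hessian ::
  "('a, 'e::finite_dim_inner) chart \<Rightarrow> ('a \<Rightarrow> real) \<Rightarrow> 'a \<Rightarrow> 'e \<Rightarrow> 'e \<Rightarrow> real" where
  "coord_hessian c f p v w =
     frechet_derivative (\<lambda>y. frechet_derivative (f \<circ> chart_inv c) (at y) w) (at (snd c p)) v"

text \<open>At a critical point, the non-degeneracy of the Hessian does not depend on the chart.\<close>

definition nondegenerate_critical_point ::
  "('a::topological_space, 'e::finite_dim_inner) chart set \<Rightarrow> ('a \<Rightarrow> real) \<Rightarrow> 'a \<Rightarrow> bool" where
  "nondegenerate_critical_point A f p \<longleftrightarrow> critical_point A f p \<and>
     (\<forall>c\<in>A. p \<in> fst c \<longrightarrow> (\<forall>v. (\<forall>w. coord_hessian c f p v w = 0) \<longrightarrow> v = 0))"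

definition morse_function ::
  "('a::topological_space, 'e::finite_dim_inner) chart set \<Rightarrow> ('a \<Rightarrow> real) \<Rightarrow> bool" where
  "morse_function A f \<longleftrightarrow> smooth_function A f \<and>
     (\<forall>p. critical_point A f p \<longrightarrow> nondegenerate_critical_point A f p)"


subsection \<open>The negative gradient flow\<close>

definition is_negative_gradient_flow ::
  "('a::topological_space, 'e::finite_dim_inner) chart set \<Rightarrow>
   ('a \<Rightarrow> ('a, 'e) tvec \<Rightarrow> ('a, 'e) tvec \<Rightarrow> real) \<Rightarrow> ('a \<Rightarrow> real) \<Rightarrow> ('a \<Rightarrow> real \<Rightarrow> 'a) \<Rightarrow> bool" where
  "is_negative_gradient_flow A g f \<Phi> \<longleftrightarrow>
     (\<forall>x. \<Phi> x 0 = x \<and> (\<forall>t. has_velocity A (\<Phi> x) (\<lambda>c. - gradient A g f (\<Phi> x t) c) t))"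

text \<open>On a compact manifold there is exactly one such map, so that the description is proper.\<close>

definition negative_gradient_flow ::
  "('a::topological_space, 'e::finite_dim_inner) chart set \<Rightarrow>
   ('a \<Rightarrow> ('a, 'e) tvec \<Rightarrow> ('a, 'e) tvec \<Rightarrow> real) \<Rightarrow> ('a \<Rightarrow> real) \<Rightarrow> 'a \<Rightarrow> real \<Rightarrow> 'a" where
  "negative_gradient_flow A g f = (THE \<Phi>. is_negative_gradient_flow A g f \<Phi>)"

definition flows_to ::
  "('a::topological_space, 'e::finite_dim_inner) chart set \<Rightarrow>
   ('a \<Rightarrow> ('a, 'e) tvec \<Rightarrow> ('a, 'e) tvec \<Rightarrow> real) \<Rightarrow> ('a \<Rightarrow> real) \<Rightarrow> 'a \<Rightarrow> 'a \<Rightarrow> bool" where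
  "flows_to A g f a b \<longleftrightarrow> (\<exists>x. \<not> critical_point A f x \<and>
     (negative_gradient_flow A g f x \<longlongrightarrow> a) at_bot \<and>
     (negative_gradient_flow A g f x \<longlongrightarrow> b) at_top)"

end

theory Submission
  imports Defs
begin

text \<open>
  Every orbit of the flow converges in both directions to a critical point, because \<open>f\<close>
  decreases strictly along non-constant orbits, the manifold is compact and the critical points are
  isolated. So the manifold is the disjoint union of the stable sets of its critical points. Call two
  critical points equivalent when finitely many orbits join them as in the theorem. The union of the
  stable sets over an equivalence class turns out to be closed. There are finitely many classes, so
  the complement of such a union is closed too, and connectedness leaves room for one class only.

  Closedness comes from broken orbits. Let \<open>x\<close> lie in the closure of the stable set of \<open>q\<close> and let
  its orbit converge to \<open>p\<close>. Then \<open>p\<close> lies in that closure as well, which is closed and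
  invariant. If \<open>p\<close> differs from \<open>q\<close>, take points of the stable set of \<open>q\<close> that tend to \<open>p\<close>: their
  orbits have to leave a small neighbourhood of \<open>p\<close>, they need longer and longer to do so, and a
  limit \<open>w\<close> of the exit points has its whole backward orbit near \<open>p\<close>. Hence \<open>w\<close> flows from \<open>p\<close>
  to some \<open>r\<close>, which is again in the closure of the stable set of \<open>q\<close> and has a smaller
  value of \<open>f\<close> (lemma \<open>broken_orbit_step\<close>). After finitely many steps \<open>q\<close> is reached. The Morse
  condition enters through the isolation of the critical points (lemma
  \<open>nondegenerate_imp_isolated\<close>): at a critical point the derivative of the partial derivatives
  of \<open>f\<close> is the Hessian, which is injective.

  It remains to construct the flow. In a chart the gradient solves a linear system whose coefficients
  are locally Lipschitz, so that it is locally Lipschitz itself (lemma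
  \<open>represented_field_lipschitz\<close>). Picard iteration gives local
  integral curves, and an estimate of Gronwall type gives their uniqueness and their continuous
  dependence on the initial point (lemmas \<open>picard_local_solutions\<close> and
  \<open>lipschitz_curves_norm_le\<close>). On a compact manifold the time of existence is bounded
  below, and integral curves can be continued for all times. Since the model space is any
  finite-dimensional inner product space, possibly of dimension zero, its compactness and
  completeness properties are derived from an orthonormal basis.
\<close>

section \<open>Gradient-like flows on compact spaces\<close>

text \<open>
  The dynamical part of the proof concerns a continuous flow on a compact space with a
  Lyapunov function that decreases strictly off an isolated set of fixed points. This setting is
  invariant under time reversal with \<open>- f\<close> in place of \<open>f\<close>, which gives statements about backward
  orbits for free.
\<close>

locale gradient_like_flow =
  fixes \<Phi> :: "'a::{t2_space, second_countable_topology} \<Rightarrow> real \<Rightarrow> 'a"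
    and f :: "'a \<Rightarrow> real"
    and C :: "'a set"
  assumes compact_space: "compact (UNIV :: 'a set)"
    and flow_zero: "\<Phi> x 0 = x"
    and flow_add: "\<Phi> (\<Phi> x s) t = \<Phi> x (s + t)"
    and continuous_flow: "continuous_on UNIV (\<lambda>(x, t). \<Phi> x t)"
    and continuous_f: "continuous_on UNIV f"
    and fixed: "x \<in> C \<Longrightarrow> \<Phi> x t = x"
    and decreasing: "x \<notin> C \<Longrightarrow> 0 < t \<Longrightarrow> f (\<Phi> x t) < f x"
    and isolated: "p \<in> C \<Longrightarrow> \<exists>U. open U \<and> U \<inter> C = {p}"
begin

lemma flow_tendsto:
  assumes "(u \<longlongrightarrow> x) F" and "(v \<longlongrightarrow> t) F"
  shows "((\<lambda>n. \<Phi> (u n) (v n)) \<longlongrightarrow> \<Phi> x t) F"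
proof -
  have "((\<lambda>n. (\<lambda>(x, t). \<Phi> x t) (u n, v n)) \<longlongrightarrow> (\<lambda>(x, t). \<Phi> x t) (x, t)) F"
    using continuous_on_tendsto_compose[OF continuous_flow tendsto_Pair[OF assms]] by simp
  then show ?thesis by simp
qed

lemma f_tendsto:
  assumes "(u \<longlongrightarrow> x) F"
  shows "((\<lambda>n. f (u n)) \<longlongrightarrow> f x) F"
  by (rule continuous_on_tendsto_compose[OF continuous_f assms]) auto

lemma continuous_time_map: "continuous_on S (\<lambda>x. \<Phi> x t)"
  unfolding continuous_on by (intro ballI flow_tendsto tendsto_const tendsto_ident_at)

lemma continuous_orbit: "continuous_on S (\<Phi> x)"
  unfolding continuous_on by (intro ballI flow_tendsto tendsto_const tendsto_ident_at)

lemma f_flow_antimono: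
  assumes "s \<le> t"
  shows "f (\<Phi> x t) \<le> f (\<Phi> x s)"
proof -
  have eq: "\<Phi> x t = \<Phi> (\<Phi> x s) (t - s)" by (simp add: flow_add)
  consider "s = t" | "\<Phi> x s \<in> C" | "s < t" "\<Phi> x s \<notin> C" using assms by linarith
  then show ?thesis
  proof cases
    case 2
    then show ?thesis by (simp add: eq fixed)
  next
    case 3
    then show ?thesis using decreasing[of "\<Phi> x s" "t - s"] eq by simp
  qed simp
qed

lemma critical_iff_fixed: "x \<in> C \<longleftrightarrow> \<Phi> x 1 = x"
  using fixed[of x 1] decreasing[of x 1] by (metis less_irrefl zero_less_one)

lemma closed_critical: "closed C"
proof -
  have "C = {x. \<Phi> x 1 = id x}" using critical_iff_fixed by auto
  then show ?thesis
    using closed_Collect_eq[of "\<lambda>x. \<Phi> x 1" id] continuous_time_map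
    by (simp add: continuous_on_id')
qed

lemma finite_critical: "finite C"
proof -
  have comp: "compact C"
    using closed_critical compact_space compact_Int_closed[of UNIV C] by simp
  obtain U where U: "\<And>p. p \<in> C \<Longrightarrow> open (U p) \<and> U p \<inter> C = {p}"
    using isolated by metis
  obtain D where D: "D \<subseteq> C" "finite D" "C \<subseteq> (\<Union>p\<in>D. U p)"
    by (rule compactE_image[OF comp, of C U]) (use U in blast)+
  have "C \<subseteq> D"
  proof
    fix c assume "c \<in> C"
    then obtain p where "p \<in> D" "c \<in> U p" using D(3) by auto
    with \<open>c \<in> C\<close> have "c \<in> U p \<inter> C" "U p \<inter> C = {p}" using D(1) U by auto
    with \<open>p \<in> D\<close> show "c \<in> D" by simp
  qed
  with D(2) show ?thesis by (rule finite_subset[rotated])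
qed

lemma isolating_neighbourhood:
  assumes "p \<in> C"
  obtains N where "open N" "p \<in> N" "closure N \<inter> C = {p}"
proof -
  have "\<forall>c\<in>C - {p}. \<exists>U V. open U \<and> open V \<and> p \<in> U \<and> c \<in> V \<and> U \<inter> V = {}"
    by (intro ballI) (metis DiffE insertCI separation_t2)
  then obtain U V where UV: "\<And>c. c \<in> C - {p} \<Longrightarrow>
      open (U c) \<and> open (V c) \<and> p \<in> U c \<and> c \<in> V c \<and> U c \<inter> V c = {}"
    by metis
  define N where "N = (\<Inter>c\<in>C - {p}. U c)"
  have N: "open N" "p \<in> N"
    using UV finite_critical by (auto simp: N_def)
  have "c \<notin> closure N" if "c \<in> C - {p}" for c
  proof -
    have "N \<subseteq> - V c" using UV[OF that] that by (auto simp: N_def)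
    then have "closure N \<subseteq> - V c" using UV[OF that] by (intro closure_minimal) auto
    then show ?thesis using UV[OF that] by auto
  qed
  with N assms closure_subset[of N] show ?thesis by (intro that[of N]) auto
qed

lemma convergent_subsequence:
  fixes u :: "nat \<Rightarrow> 'a"
  obtains l r where "strict_mono (r :: nat \<Rightarrow> nat)" "(\<lambda>n. u (r n)) \<longlonglongrightarrow> l"
  proof -
  obtain l r where "strict_mono r" "(u \<circ> r) \<longlonglongrightarrow> l"
    by (rule seq_compactE[OF compact_imp_seq_compact[OF compact_space], of u]) auto
  then show ?thesis by (intro that[of r l]) (simp_all add: o_def)
qed

text \<open>
  Along the orbit of \<open>x\<close> the values of \<open>f\<close> decrease to a limit, which is the value of \<open>f\<close> at \<open>z\<close>
  and also at the time-one image of \<open>z\<close>. So \<open>f\<close> does not decrease along the orbit of \<open>z\<close>.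
\<close>

lemma limit_point_critical:
  assumes t: "filterlim t at_top sequentially" and z: "(\<lambda>n. \<Phi> x (t n)) \<longlonglongrightarrow> z"
  shows "z \<in> C"
proof (rule ccontr)
  assume "z \<notin> C"
  have "f z \<le> f (\<Phi> x (t n + 1))" for n
  proof (rule tendsto_upperbound[OF f_tendsto[OF z]])
    have "\<forall>\<^sub>F m in sequentially. t n + 1 \<le> t m"
      using t by (simp add: filterlim_at_top)
    then show "\<forall>\<^sub>F m in sequentially. f (\<Phi> x (t m)) \<le> f (\<Phi> x (t n + 1))"
      by (rule eventually_mono) (rule f_flow_antimono)
  qed simp
  moreover have "(\<lambda>n. f (\<Phi> x (t n + 1))) \<longlonglongrightarrow> f (\<Phi> z 1)"
    using f_tendsto[OF flow_tendsto[OF z tendsto_const[of 1]]] by (simp add: flow_add)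
  ultimately have "f z \<le> f (\<Phi> z 1)"
    by (intro tendsto_lowerbound[where F = sequentially]) auto
  with decreasing[OF \<open>z \<notin> C\<close>, of 1] show False by simp
qed

text \<open>
  A limit point \<open>p\<close> of the orbit exists by compactness and is critical. If the orbit left a
  small neighbourhood of \<open>p\<close> again and again, it would cross the frontier of that neighbourhood
  at arbitrarily late times, and the frontier would contain a further critical point.
\<close>

lemma orbit_converges:
  obtains p where "p \<in> C" "(\<Phi> x \<longlongrightarrow> p) at_top"
proof -
  obtain p r where r: "strict_mono (r :: nat \<Rightarrow> nat)" and p: "(\<lambda>n. \<Phi> x (real (r n))) \<longlonglongrightarrow> p"
    by (rule convergent_subsequence[of "\<lambda>n. \<Phi> x (real n)"])
  have r_top: "filterlim (\<lambda>n. real (r n)) at_top sequentially"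
    using filterlim_compose[OF filterlim_real_sequentially filterlim_subseq[OF r]] .
  have "p \<in> C" by (rule limit_point_critical[OF r_top p])
  then obtain N where N: "open N" "p \<in> N" "closure N \<inter> C = {p}"
    by (rule isolating_neighbourhood)
  have "(\<Phi> x \<longlongrightarrow> p) at_top"
  proof (rule topological_tendstoI, rule ccontr)
    fix O' assume O': "open O'" "p \<in> O'" and "\<not> (\<forall>\<^sub>F t in at_top. \<Phi> x t \<in> O')"
    then have out: "\<exists>t\<ge>T. \<Phi> x t \<notin> O' \<inter> N" for T
      by (auto simp: eventually_at_top_linorder)
    have "open (O' \<inter> N)" "p \<in> O' \<inter> N" using N O' by auto
    then have in_N: "\<forall>\<^sub>F n in sequentially. \<Phi> x (real (r n)) \<in> O' \<inter> N"
      using topological_tendstoD[OF p] by blast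
    have "\<exists>t\<ge>T. \<Phi> x t \<in> frontier (O' \<inter> N)" for T
    proof -
      have "\<forall>\<^sub>F n in sequentially. T \<le> real (r n)"
        using r_top by (simp add: filterlim_at_top)
      with in_N have "\<forall>\<^sub>F n in sequentially. \<Phi> x (real (r n)) \<in> O' \<inter> N \<and> T \<le> real (r n)"
        by (rule eventually_conj)
      then obtain a where a: "\<Phi> x a \<in> O' \<inter> N" "T \<le> a"
        by (auto simp: eventually_sequentially)
      obtain b where b: "a \<le> b" "\<Phi> x b \<notin> O' \<inter> N" using out by blast
      have "connected (\<Phi> x ` {a..b})"
        by (rule connected_continuous_image[OF continuous_orbit]) simp
      then have "\<Phi> x ` {a..b} \<inter> frontier (O' \<inter> N) \<noteq> {}"
      proof (rule connected_Int_frontier)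
        have "\<Phi> x a \<in> \<Phi> x ` {a..b}" "\<Phi> x b \<in> \<Phi> x ` {a..b}" using b(1) by auto
        then show "\<Phi> x ` {a..b} \<inter> (O' \<inter> N) \<noteq> {}" "\<Phi> x ` {a..b} - O' \<inter> N \<noteq> {}"
          using a(1) b(2) by blast+
      qed
      with a(2) show ?thesis by force
    qed
    then have "\<forall>n. \<exists>t. real n \<le> t \<and> \<Phi> x t \<in> frontier (O' \<inter> N)" by blast
    then obtain t where t: "\<And>n. real n \<le> t n" "\<And>n. \<Phi> x (t n) \<in> frontier (O' \<inter> N)"
      unfolding choice_iff by blast
    obtain z s where s: "strict_mono (s :: nat \<Rightarrow> nat)" and z: "(\<lambda>n. \<Phi> x (t (s n))) \<longlonglongrightarrow> z"
      by (rule convergent_subsequence[of "\<lambda>n. \<Phi> x (t n)"])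
    have "filterlim t at_top sequentially"
      by (rule filterlim_at_top_mono[OF filterlim_real_sequentially]) (simp add: t(1))
    then have "filterlim (\<lambda>n. t (s n)) at_top sequentially"
      by (rule filterlim_compose[OF _ filterlim_subseq[OF s]])
    then have "z \<in> C" using z by (rule limit_point_critical)
    moreover have "z \<in> frontier (O' \<inter> N)"
      by (rule Lim_in_closed_set[OF frontier_closed _ _ z]) (auto simp: t)
    then have "z \<in> closure N" "z \<notin> O' \<inter> N"
      using closure_mono[of "O' \<inter> N" N] interior_open[OF \<open>open (O' \<inter> N)\<close>]
      unfolding frontier_def by blast+
    ultimately show False using N O' by auto
  qed
  with \<open>p \<in> C\<close> show ?thesis by (rule that)
qed

end

lemma gradient_like_flow_reverse:
  assumes "gradient_like_flow \<Phi> f C"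
  shows "gradient_like_flow (\<lambda>x t. \<Phi> x (- t)) (\<lambda>x. - f x) C"
proof -
  interpret gradient_like_flow \<Phi> f C by (rule assms)
  show ?thesis
  proof
    show "compact (UNIV :: 'a set)" by (rule compact_space)
    show "\<Phi> x (- 0) = x" for x by (simp add: flow_zero)
    show "\<Phi> (\<Phi> x (- s)) (- t) = \<Phi> x (- (s + t))" for x s t by (simp add: flow_add)
    show "continuous_on UNIV (\<lambda>(x, t). \<Phi> x (- t))"
      unfolding continuous_on split_def
      by (intro ballI flow_tendsto tendsto_minus tendsto_fst tendsto_snd tendsto_ident_at)
    show "continuous_on UNIV (\<lambda>x. - f x)" by (intro continuous_intros continuous_f)
    show "\<Phi> x (- t) = x" if "x \<in> C" for x t using that by (rule fixed)
    show "- f (\<Phi> x (- t)) < - f x" if "x \<notin> C" "0 < t" for x t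
    proof -
      have backward: "\<Phi> (\<Phi> x (- t)) t = x" by (simp add: flow_add flow_zero)
      then have "\<Phi> x (- t) \<notin> C" using fixed that(1) by metis
      then show ?thesis using decreasing[of "\<Phi> x (- t)" t] that(2) backward by simp
    qed
    show "\<exists>U. open U \<and> U \<inter> C = {p}" if "p \<in> C" for p using that by (rule isolated)
  qed
qed

context gradient_like_flow
begin

lemma orbit_converges_backward:
  obtains p where "p \<in> C" "(\<Phi> x \<longlongrightarrow> p) at_bot"
proof -
  interpret reverse: gradient_like_flow "\<lambda>x t. \<Phi> x (- t)" "\<lambda>x. - f x" C
    by (rule gradient_like_flow_reverse) unfold_locales
  show ?thesis
    using reverse.orbit_converges[of x] that by (metis filterlim_at_bot_mirror)
qed

definition stable_set :: "'a \<Rightarrow> 'a set" where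
  "stable_set q = {x. (\<Phi> x \<longlongrightarrow> q) at_top}"

definition connects :: "'a \<Rightarrow> 'a \<Rightarrow> bool" where
  "connects a b \<longleftrightarrow> (\<exists>x. x \<notin> C \<and> (\<Phi> x \<longlongrightarrow> a) at_bot \<and> (\<Phi> x \<longlongrightarrow> b) at_top)"

lemma connects_decreases:
  assumes "connects a b"
  shows "f b < f a"
proof -
  obtain x where x: "x \<notin> C" "(\<Phi> x \<longlongrightarrow> a) at_bot" "(\<Phi> x \<longlongrightarrow> b) at_top"
    using assms by (auto simp: connects_def)
  have "f b \<le> f (\<Phi> x 1)"
    by (rule tendsto_upperbound[OF f_tendsto[OF x(3)]])
      (auto simp: eventually_at_top_linorder intro!: f_flow_antimono exI[of _ 1])
  moreover have "f x \<le> f a"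
    by (rule tendsto_lowerbound[OF f_tendsto[OF x(2)]])
      (auto simp: eventually_at_bot_linorder intro!: exI[of _ 0] dest: f_flow_antimono[of _ 0 x]
        simp: flow_zero)
  ultimately show ?thesis using decreasing[OF x(1), of 1] by simp
qed

lemma stable_set_flow:
  assumes "x \<in> stable_set q"
  shows "\<Phi> x s \<in> stable_set q"
proof -
  have "filterlim (\<lambda>t. s + t) at_top (at_top :: real filter)"
    by (rule filterlim_tendsto_add_at_top[OF tendsto_const filterlim_ident])
  then have "((\<lambda>t. \<Phi> x (s + t)) \<longlongrightarrow> q) at_top"
    using assms filterlim_compose[of "\<Phi> x" "nhds q" at_top] by (auto simp: stable_set_def)
  then show ?thesis by (simp add: stable_set_def flow_add[abs_def])
qed

lemma closure_stable_set_flow: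
  assumes "x \<in> closure (stable_set q)"
  shows "\<Phi> x s \<in> closure (stable_set q)"
proof -
  have "(\<lambda>x. \<Phi> x s) ` closure (stable_set q) \<subseteq> closure (stable_set q)"
    using stable_set_flow closure_subset
    by (intro image_closure_subset continuous_time_map) blast+
  with assms show ?thesis by blast
qed

lemma closure_stable_set_limit:
  assumes "x \<in> closure (stable_set q)" and "(\<Phi> x \<longlongrightarrow> p) at_top"
  shows "p \<in> closure (stable_set q)"
  by (rule Lim_in_closed_set[OF closed_closure _ _ assms(2)])
    (auto simp: closure_stable_set_flow[OF assms(1)])

text \<open>
  The closed set of times in \<open>{0..T}\<close> at which the orbit is outside \<open>N\<close> has a smallest element.
\<close>

lemma first_exit:
  assumes "open N" and "z \<in> N" and "0 \<le> T" and "\<Phi> z T \<notin> N"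
  obtains s where "0 \<le> s" "\<Phi> z s \<notin> N" "\<And>t. 0 \<le> t \<Longrightarrow> t \<le> s \<Longrightarrow> \<Phi> z t \<in> closure N"
proof -
  define A where "A = {0..T} \<inter> \<Phi> z -` (- N)"
  have "compact A"
    unfolding A_def using \<open>open N\<close>
    by (intro compact_Int_closed compact_Icc closed_vimage continuous_orbit) auto
  moreover have "A \<noteq> {}" using assms by (auto simp: A_def)
  ultimately obtain s where s: "s \<in> A" "\<And>t. t \<in> A \<Longrightarrow> s \<le> t"
    using compact_attains_inf[of A] by auto
  have "s \<noteq> 0" using s(1) assms(2) flow_zero[of z] by (auto simp: A_def)
  have before: "\<Phi> z t \<in> N" if "0 \<le> t" "t < s" for t
    using s(1) s(2)[of t] that by (auto simp: A_def)
  have "\<Phi> z s \<in> closure N"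
  proof (rule Lim_in_closed_set[OF closed_closure])
    show "(\<Phi> z \<longlongrightarrow> \<Phi> z s) (at_left s)"
      by (intro flow_tendsto tendsto_const tendsto_ident_at)
    show "\<forall>\<^sub>F t in at_left s. \<Phi> z t \<in> closure N"
      using s(1) \<open>s \<noteq> 0\<close> before closure_subset[of N]
      unfolding eventually_at_left_field by (intro exI[of _ 0]) (auto simp: A_def)
  qed simp
  with s(1) before closure_subset[of N] show ?thesis
    by (intro that[of s]) (auto simp: A_def less_eq_real_def)
qed

text \<open>
  The point \<open>w\<close> of the proof is a limit of the points where orbits that start near \<open>p\<close> and end at \<open>q\<close>
  leave an isolating neighbourhood \<open>N\<close> of \<open>p\<close>. The exit times tend to infinity because \<open>p\<close> is
  fixed, so that the backward orbit of \<open>w\<close> stays in the closure of \<open>N\<close> for ever and can only converge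
  to \<open>p\<close>.
\<close>

lemma broken_orbit_step:
  assumes "p \<in> C" and "q \<in> C" and "p \<noteq> q" and "p \<in> closure (stable_set q)"
  obtains r where "r \<in> C" "connects p r" "r \<in> closure (stable_set q)"
proof -
  obtain N where N: "open N" "p \<in> N" "closure N \<inter> C = {p}"
    using \<open>p \<in> C\<close> by (rule isolating_neighbourhood)
  have "p \<in> closure (N \<inter> stable_set q)"
    using N assms(4) open_Int_closure_subset[of N "stable_set q"] by auto
  then obtain z where z: "\<And>k. z k \<in> N" "\<And>k. z k \<in> stable_set q" "z \<longlonglongrightarrow> p"
    unfolding closure_sequential by blast
  have "\<exists>s. 0 \<le> s \<and> \<Phi> (z k) s \<notin> N \<and> (\<forall>t. 0 \<le> t \<longrightarrow> t \<le> s \<longrightarrow> \<Phi> (z k) t \<in> closure N)" for k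
  proof -
    have "q \<in> - closure N" using N assms by auto
    with z(2)[of k] have "\<forall>\<^sub>F t in at_top. \<Phi> (z k) t \<in> - closure N"
      by (auto simp: stable_set_def dest!: topological_tendstoD[of _ _ _ "- closure N"])
    with eventually_ge_at_top[of "0 :: real"]
    have "\<forall>\<^sub>F t in at_top. 0 \<le> t \<and> \<Phi> (z k) t \<in> - closure N" by (rule eventually_conj)
    then obtain T where "0 \<le> T" "\<Phi> (z k) T \<notin> N"
      using closure_subset[of N] by (auto simp: eventually_at_top_linorder)
    then show ?thesis using first_exit[OF N(1) z(1)] by metis
  qed
  then obtain s where s: "\<And>k. 0 \<le> s k" "\<And>k. \<Phi> (z k) (s k) \<notin> N"
      "\<And>k t. 0 \<le> t \<Longrightarrow> t \<le> s k \<Longrightarrow> \<Phi> (z k) t \<in> closure N"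
    by metis
  have late: "\<forall>\<^sub>F k in sequentially. T < s k" for T
  proof -
    let ?W = "(\<lambda>(x, t). \<Phi> x t) -` N"
    have W: "open ?W" by (rule open_vimage[OF N(1) continuous_flow])
    have pW: "{p} \<times> {0..T} \<subseteq> ?W" using fixed[OF \<open>p \<in> C\<close>] N by auto
    obtain X where X: "p \<in> X" "open X" "X \<times> {0..T} \<subseteq> ?W"
      using Elementary_Topology.tube_lemma[OF compact_Icc W pW] by blast
    have "\<forall>\<^sub>F k in sequentially. z k \<in> X" using z(3) X by (simp add: topological_tendstoD)
    then show ?thesis
    proof (rule eventually_mono)
      fix k assume "z k \<in> X"
      show "T < s k"
      proof (rule ccontr)
        assume "\<not> T < s k"
        then have "(z k, s k) \<in> ?W" using X(3) \<open>z k \<in> X\<close> s(1)[of k] by force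
        with s(2)[of k] show False by simp
      qed
    qed
  qed
  obtain w j where j: "strict_mono (j :: nat \<Rightarrow> nat)"
      and w: "(\<lambda>n. \<Phi> (z (j n)) (s (j n))) \<longlonglongrightarrow> w"
    by (rule convergent_subsequence[of "\<lambda>k. \<Phi> (z k) (s k)"])
  have w_out: "w \<notin> N"
    using Lim_in_closed_set[OF _ _ _ w, of "- N"] N(1) s(2) by auto
  have w_closure: "w \<in> closure (stable_set q)"
  proof (rule Lim_in_closed_set[OF closed_closure _ _ w])
    have "\<Phi> (z (j n)) (s (j n)) \<in> closure (stable_set q)" for n
      using stable_set_flow[OF z(2)] closure_subset by blast
    then show "\<forall>\<^sub>F n in sequentially. \<Phi> (z (j n)) (s (j n)) \<in> closure (stable_set q)"
      by simp
  qed simp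
  have backward: "\<Phi> w (- t) \<in> closure N" if "0 \<le> t" for t
  proof (rule Lim_in_closed_set[OF closed_closure])
    show "(\<lambda>n. \<Phi> (z (j n)) (s (j n) - t)) \<longlonglongrightarrow> \<Phi> w (- t)"
      using flow_tendsto[OF w tendsto_const[of "- t"]] by (simp add: flow_add)
    have "\<forall>\<^sub>F n in sequentially. t < s (j n)"
      using eventually_subseq[OF j late] .
    then show "\<forall>\<^sub>F n in sequentially. \<Phi> (z (j n)) (s (j n) - t) \<in> closure N"
      by (rule eventually_mono) (use s(3) that in auto)
  qed simp
  have "w \<notin> C" using backward[of 0] w_out N by (auto simp: flow_zero)
  obtain p' where p': "p' \<in> C" "(\<Phi> w \<longlongrightarrow> p') at_bot" by (rule orbit_converges_backward)
  have "p' \<in> closure N"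
  proof (rule Lim_in_closed_set[OF closed_closure _ _ p'(2)])
    show "\<forall>\<^sub>F t in at_bot. \<Phi> w t \<in> closure N"
      unfolding eventually_at_bot_linorder using backward[of "- t" for t] by (intro exI[of _ 0]) force
  qed simp
  with p' N have "p' = p" by blast
  obtain r where r: "r \<in> C" "(\<Phi> w \<longlongrightarrow> r) at_top" by (rule orbit_converges)
  show ?thesis
    using that[of r] r p'(2) \<open>p' = p\<close> \<open>w \<notin> C\<close> closure_stable_set_limit[OF w_closure r(2)]
    by (auto simp: connects_def)
qed

definition linked :: "'a \<Rightarrow> 'a \<Rightarrow> bool" where
  "linked a b \<longleftrightarrow> a \<in> C \<and> b \<in> C \<and> (connects a b \<or> connects b a)"

lemma linked_rtranclp_sym: "linked\<^sup>*\<^sup>* a b \<Longrightarrow> linked\<^sup>*\<^sup>* b a"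
  by (rule symp_rtranclp[THEN sympD]) (auto simp: symp_def linked_def)

text \<open>
  Each broken orbit step lowers the value of \<open>f\<close>, and there are finitely many critical points.
\<close>

lemma linked_closure_stable_set:
  assumes "p \<in> C" and "q \<in> C" and "p \<in> closure (stable_set q)"
  shows "linked\<^sup>*\<^sup>* p q"
  using assms(1,3)
proof (induction "card {c\<in>C. f c < f p}" arbitrary: p rule: less_induct)
  case less
  show ?case
  proof (cases "p = q")
    case False
    with less.prems \<open>q \<in> C\<close> obtain r
      where r: "r \<in> C" "connects p r" "r \<in> closure (stable_set q)"
      by (metis broken_orbit_step)
    have "f r < f p" using r(2) by (rule connects_decreases)
    then have "{c\<in>C. f c < f r} \<subset> {c\<in>C. f c < f p}" using r(1) by auto
    then have "card {c\<in>C. f c < f r} < card {c\<in>C. f c < f p}"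
      using finite_critical by (intro psubset_card_mono) auto
    with less.hyps r have "linked\<^sup>*\<^sup>* r q" by blast
    moreover have "linked p r" using less.prems r by (simp add: linked_def)
    ultimately show ?thesis by (rule converse_rtranclp_into_rtranclp[rotated])
  qed simp
qed

theorem critical_points_linked:
  assumes conn: "connected (UNIV :: 'a set)" and "p \<in> C" and "q \<in> C"
  shows "linked\<^sup>*\<^sup>* p q"
proof -
  define W where "W D = (\<Union>r\<in>D. stable_set r)" for D
  \<comment> \<open>a limit of points of \<open>W D\<close> is a limit of points of a single stable set, as \<open>D\<close> is finite\<close>
  have closed_W: "closed (W D)"
    if D: "D \<subseteq> C" "\<And>r r'. r \<in> D \<Longrightarrow> linked\<^sup>*\<^sup>* r' r \<Longrightarrow> r' \<in> C \<Longrightarrow> r' \<in> D" for D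
  proof -
    have fin: "finite D" using D(1) finite_critical by (rule finite_subset)
    then have closure_W: "closure (W D) = (\<Union>r\<in>D. closure (stable_set r))"
      by (induction D) (simp_all add: W_def closure_Un)
    have "closure (W D) \<subseteq> W D"
    proof
      fix x assume "x \<in> closure (W D)"
      then obtain r where r: "r \<in> D" "x \<in> closure (stable_set r)"
        using closure_W by blast
      obtain r' where r': "r' \<in> C" "(\<Phi> x \<longlongrightarrow> r') at_top" by (rule orbit_converges)
      have "linked\<^sup>*\<^sup>* r' r"
        using r r' D(1) closure_stable_set_limit by (intro linked_closure_stable_set) auto
      then have "r' \<in> D" using D(2) r r' by blast
      then show "x \<in> W D" using r'(2) by (auto simp: W_def stable_set_def)
    qed
    then show ?thesis using closure_subset_eq by blast
  qed
  define E where "E = {r\<in>C. linked\<^sup>*\<^sup>* p r}"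
  have "closed (W E)"
    by (rule closed_W) (auto simp: E_def intro: rtranclp_trans dest: linked_rtranclp_sym)
  moreover have "closed (W (C - E))"
    by (rule closed_W) (auto simp: E_def intro: rtranclp_trans)
  moreover have unique: "r = r'" if "x \<in> stable_set r" "x \<in> stable_set r'" for x r r'
    using that tendsto_unique[of at_top "\<Phi> x" r r'] by (simp add: stable_set_def)
  then have "W E \<inter> W (C - E) = {}" by (auto simp: W_def)
  moreover have "UNIV \<subseteq> W E \<union> W (C - E)"
  proof
    fix x show "x \<in> W E \<union> W (C - E)"
      using orbit_converges[of x] by (auto simp: W_def stable_set_def)
  qed
  moreover have self: "c \<in> stable_set c" if "c \<in> C" for c
    using that by (simp add: stable_set_def tendsto_eventually fixed)
  then have "p \<in> W E" using \<open>p \<in> C\<close> by (auto simp: W_def E_def)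
  ultimately have "W (C - E) = {}"
    using conn[unfolded connected_closed, rule_format] by blast
  then have "q \<in> E" using self[OF \<open>q \<in> C\<close>] \<open>q \<in> C\<close> by (auto simp: W_def)
  then show ?thesis by (simp add: E_def)
qed

end

section \<open>Finite-dimensional inner product spaces\<close>

lemma finite_orthonormal_basis:
  obtains B :: "'e::finite_dim_inner set"
  where "finite B" "pairwise orthogonal B" "\<And>b. b \<in> B \<Longrightarrow> norm b = 1" "span B = UNIV"
proof -
  obtain B0 :: "'e set" where B0: "finite B0" "\<And>x. \<exists>r. x = (\<Sum>b\<in>B0. r b *\<^sub>R b)"
    using finite_dim by metis
  have "span B0 = UNIV"
  proof -
    have "x \<in> span B0" for x
    proof -
      obtain r where "x = (\<Sum>b\<in>B0. r b *\<^sub>R b)" using B0(2) by blast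
      then show ?thesis by (simp add: span_sum span_scale span_base)
    qed
    then show ?thesis by auto
  qed
  obtain C where C: "finite C" "span C = span B0" "pairwise orthogonal C"
    using basis_orthogonal[OF B0(1)] by blast
  define B where "B = (\<lambda>b. b /\<^sub>R norm b) ` (C - {0})"
  show ?thesis
  proof (rule that[of B])
    show "finite B" using C by (simp add: B_def)
    show "pairwise orthogonal B"
      using C(3) unfolding B_def pairwise_def orthogonal_def by fastforce
    show "norm b = 1" if "b \<in> B" for b 
      using that unfolding B_def by (elim imageE) simp
    have "C \<subseteq> span B"
    proof
      fix c assume "c \<in> C"
      show "c \<in> span B"
      proof (cases "c = 0")
        case False
        then have "c /\<^sub>R norm c \<in> B" unfolding B_def using \<open>c \<in> C\<close> by (intro imageI) simp
        then have "c /\<^sub>R norm c \<in> span B" by (rule span_base)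
        then have "norm c *\<^sub>R (c /\<^sub>R norm c) \<in> span B" by (rule span_scale)
        then show ?thesis using False by simp
      qed (simp add: span_zero)
    qed
    then have "span C \<subseteq> span B" by (rule span_minimal[OF _ subspace_span])
    then show "span B = UNIV" using C \<open>span B0 = UNIV\<close> by auto
  qed
qed

text \<open>
  The form in which finite dimension is used below: coordinates with respect to an orthonormal basis.
\<close>

lemma finite_coordinates:
  obtains B :: "'e::finite_dim_inner set"
  where "finite B" "\<And>x. (\<Sum>b\<in>B. (x \<bullet> b) *\<^sub>R b) = x" "\<And>b. b \<in> B \<Longrightarrow> norm b = 1"
    "\<And>c k. k \<in> B \<Longrightarrow> (\<Sum>b\<in>B. c b *\<^sub>R b) \<bullet> k = c k"
    "independent B" "span B = UNIV"
proof -
  obtain B :: "'e set" where B: "finite B" "pairwise orthogonal B" "\<And>b. b \<in> B \<Longrightarrow> norm b = 1"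
      "span B = UNIV"
    by (rule finite_orthonormal_basis) blast
  show ?thesis
  proof (rule that[of B])
    show "(\<Sum>b\<in>B. (x \<bullet> b) *\<^sub>R b) = x" for x
      using B by (intro orthonormal_basis_expand) auto
    show "(\<Sum>b\<in>B. c b *\<^sub>R b) \<bullet> k = c k" if "k \<in> B" for c k
    proof -
      have "(\<Sum>b\<in>B. c b *\<^sub>R b) \<bullet> k = (\<Sum>b\<in>B. if b = k then c b else 0)"
        unfolding inner_sum_left using B(2,3) that
        by (intro sum.cong) (auto simp: pairwise_def orthogonal_def norm_eq_1)
      then show ?thesis using B(1) that by simp
    qed
    show "independent B"
      using B(2,3) by (intro pairwise_orthogonal_independent) force+
  qed (use B in auto)
qed

text \<open>
  A bounded sequence has bounded coordinates, and passing to subsequences one coordinate at a time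
  makes all of them converge.
\<close>

instance finite_dim_inner \<subseteq> heine_borel
proof
  fix f :: "nat \<Rightarrow> 'a"
  assume bounded: "bounded (range f)"
  obtain B :: "'a set" where B: "finite B" "\<And>x. (\<Sum>b\<in>B. (x \<bullet> b) *\<^sub>R b) = x"
      "\<And>c k. k \<in> B \<Longrightarrow> (\<Sum>b\<in>B. c b *\<^sub>R b) \<bullet> k = c k"
    by (rule finite_coordinates) blast
  have "\<forall>D\<subseteq>B. \<exists>l::'a. \<exists>r::nat\<Rightarrow>nat. strict_mono r \<and>
      (\<forall>\<epsilon>>0. \<forall>\<^sub>F n in sequentially. \<forall>i\<in>D. dist (f (r n) \<bullet> i) (l \<bullet> i) < \<epsilon>)"
  proof (rule compact_lemma_general[where unproj = "\<lambda>c. \<Sum>b\<in>B. c b *\<^sub>R b"])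
    show "finite B" by (rule B)
    show "bounded ((\<lambda>x. x \<bullet> k) ` range f)" for k
      by (rule bounded_linear_image[OF bounded bounded_linear_inner_left])
    show "(\<Sum>b\<in>B. c b *\<^sub>R b) \<bullet> k = c k" if "k \<in> B" for c k
      using that by (rule B)
    show "(\<Sum>b\<in>B. (x \<bullet> b) *\<^sub>R b) = x" for x by (rule B)
  qed
  then obtain l r where r: "strict_mono (r :: nat \<Rightarrow> nat)"
    and l: "\<And>\<epsilon>. \<epsilon> > 0 \<Longrightarrow> \<forall>\<^sub>F n in sequentially. \<forall>i\<in>B. dist (f (r n) \<bullet> i) (l \<bullet> i) < \<epsilon>"
    by blast
  have "(\<lambda>n. f (r n) \<bullet> b) \<longlonglongrightarrow> l \<bullet> b" if "b \<in> B" for b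
    by (rule tendstoI, drule l, erule eventually_mono) (use that in blast)
  then have "(\<lambda>n. \<Sum>b\<in>B. (f (r n) \<bullet> b) *\<^sub>R b) \<longlonglongrightarrow> (\<Sum>b\<in>B. (l \<bullet> b) *\<^sub>R b)"
    by (intro tendsto_sum tendsto_scaleR tendsto_const)
  then have "(f \<circ> r) \<longlonglongrightarrow> l" by (simp add: B(2) o_def)
  with r show "\<exists>l r. strict_mono r \<and> (f \<circ> r) \<longlonglongrightarrow> l" by blast
qed

instance finite_dim_inner \<subseteq> banach ..

lemma linearI_combination:
  fixes h :: "'v::real_vector \<Rightarrow> 'w::real_vector"
  assumes "\<And>r u v. h (r *\<^sub>R u + v) = r *\<^sub>R h u + h v"
  shows "linear h"
proof -
  have zero: "h 0 = 0" using assms[of 1 0 0] by simp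
  show ?thesis
  proof (rule linearI)
    show "h (u + v) = h u + h v" for u v using assms[of 1 u v] by simp
    show "h (r *\<^sub>R u) = r *\<^sub>R h u" for r u using assms[of r u 0] zero by simp
  qed
qed

lemma linear_bounded_finite_dim:
  fixes T :: "'e::finite_dim_inner \<Rightarrow> 'b::real_normed_vector"
  assumes "linear T"
  shows "bounded_linear T"
proof -
  interpret T: linear T by (rule assms)
  obtain B :: "'e set" where B: "finite B" "\<And>x. (\<Sum>b\<in>B. (x \<bullet> b) *\<^sub>R b) = x"
    by (rule finite_coordinates) blast
  have "T = (\<lambda>x. \<Sum>b\<in>B. (x \<bullet> b) *\<^sub>R T b)"
    using B(2) by (metis (no_types, lifting) T.scaleR T.sum sum.cong)
  moreover have "bounded_linear (\<lambda>x. \<Sum>b\<in>B. (x \<bullet> b) *\<^sub>R T b)"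
    by (intro bounded_linear_sum bounded_linear_scaleR_left[THEN bounded_linear_compose]
        bounded_linear_inner_left)
  ultimately show ?thesis by simp
qed

text \<open>
  The linear map that sends \<open>u\<close> to the coordinates of the functional \<open>G u\<close> is injective by
  positivity, hence surjective by finite dimension.
\<close>

lemma riesz_positive_form:
  fixes G :: "'e::finite_dim_inner \<Rightarrow> 'e \<Rightarrow> real"
  assumes left: "\<And>w. linear (\<lambda>u. G u w)" and right: "\<And>u. linear (G u)"
    and positive: "\<And>u. u \<noteq> 0 \<Longrightarrow> G u u > 0" and l: "linear l"
  obtains u where "\<And>w. G u w = l w"
proof -
  obtain B :: "'e set" where B: "finite B" "\<And>x. (\<Sum>b\<in>B. (x \<bullet> b) *\<^sub>R b) = x"
      "\<And>c k. k \<in> B \<Longrightarrow> (\<Sum>b\<in>B. c b *\<^sub>R b) \<bullet> k = c k"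
      "independent B" "span B = UNIV"
    by (rule finite_coordinates) blast
  have expand: "h w = (\<Sum>b\<in>B. (w \<bullet> b) *\<^sub>R h b)" if "linear h" for h :: "'e \<Rightarrow> real" and w
  proof -
    interpret h: linear h by (rule that)
    have "h w = h (\<Sum>b\<in>B. (w \<bullet> b) *\<^sub>R b)" by (simp add: B(2))
    then show ?thesis by (simp add: h.sum h.scaleR)
  qed
  define T where "T u = (\<Sum>b\<in>B. G u b *\<^sub>R b)" for u
  have T_coord: "T u \<bullet> b = G u b" if "b \<in> B" for u b
    unfolding T_def using that by (rule B(3))
  interpret fd: finite_dimensional_vector_space "scaleR :: real \<Rightarrow> 'e \<Rightarrow> 'e" B
    using B by unfold_locales (auto simp: dependent_raw_def[symmetric] span_raw_def[symmetric])
  have lin: "linear T"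
    by (rule linearI) (simp_all add: T_def linear_add[OF left] linear_cmul[OF left]
        scaleR_add_left sum.distrib scaleR_sum_right)
  have "inj T"
  proof (rule linear_injective_0[OF lin, THEN iffD2], intro allI impI)
    fix u assume "T u = 0"
    then have "G u b = 0" if "b \<in> B" for b using T_coord[OF that, of u] by simp
    then have "G u u = 0" using expand[OF right, of u u] by simp
    with positive show "u = 0" by force
  qed
  then have "surj T" using lin fd.linear_inj_imp_surj by (simp add: linear_def)
  then obtain u where u: "T u = (\<Sum>b\<in>B. l b *\<^sub>R b)" by (metis surjD)
  have "G u b = l b" if "b \<in> B" for b
  proof -
    have "G u b = (\<Sum>b\<in>B. l b *\<^sub>R b) \<bullet> b" using T_coord[OF that, of u] u by simp
    then show ?thesis using B(3)[OF that, of l] by simp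
  qed
  then have "G u w = l w" for w using expand[OF right, of u w] expand[OF l, of w] by simp
  then show ?thesis by (rule that)
qed

lemma compact_sphere_finite_dim: "compact (sphere (a::'e::finite_dim_inner) r)"
proof -
  have "sphere a r = cball a r - ball a r" by auto
  then show ?thesis by (simp add: compact_diff)
qed

lemma injective_linear_bounded_below:
  fixes H :: "'e::finite_dim_inner \<Rightarrow> 'b::real_normed_vector"
  assumes "linear H" and inj: "\<And>v. H v = 0 \<Longrightarrow> v = 0"
  obtains c where "c > 0" "\<And>v. c * norm v \<le> norm (H v)"
proof -
  interpret H: bounded_linear H using assms(1) by (rule linear_bounded_finite_dim)
  let ?S = "sphere (0::'e) 1"
  obtain c where c: "c > 0" "\<And>v. v \<in> ?S \<Longrightarrow> c \<le> norm (H v)"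
  proof (cases "?S = {}")
    case True
    with that[of 1] show ?thesis by auto
  next
    case False
    have "compact ?S" by (rule compact_sphere_finite_dim)
    moreover have "continuous_on ?S (\<lambda>v. norm (H v))"
      by (intro continuous_intros H.continuous_on)
    ultimately have "\<exists>v\<in>?S. \<forall>w\<in>?S. norm (H v) \<le> norm (H w)"
      using False continuous_attains_inf[of ?S "\<lambda>v. norm (H v)"] by simp
    then obtain v where v: "v \<in> ?S" "\<And>w. w \<in> ?S \<Longrightarrow> norm (H v) \<le> norm (H w)"
      by blast
    have "v \<noteq> 0" using v(1) by auto
    then have "H v \<noteq> 0" using inj by blast
    then show ?thesis using v(2) by (intro that[of "norm (H v)"]) auto
  qed
  have "c * norm v \<le> norm (H v)" for v
  proof (cases "v = 0")
    case False
    then have "c \<le> norm (H (v /\<^sub>R norm v))" by (intro c(2)) simp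
    also have "\<dots> = norm (H v) / norm v" by (simp add: H.scaleR divide_inverse mult.commute)
    finally show ?thesis using False by (simp add: field_simps)
  qed (simp add: H.zero)
  with c(1) show ?thesis by (rule that)
qed

text \<open>
  Near \<open>y\<close> the map \<open>P\<close> differs from its derivative by a small multiple of the distance to \<open>y\<close>,
  whereas the derivative is at least a fixed multiple of that distance. This turns
  non-degeneracy of the Hessian into isolation of critical points.
\<close>

lemma isolated_zero:
  fixes P :: "'e::finite_dim_inner \<Rightarrow> 'b::real_normed_vector"
  assumes der: "(P has_derivative H) (at y)" and "P y = 0"
    and inj: "\<And>v. H v = 0 \<Longrightarrow> v = 0"
  shows "\<forall>\<^sub>F z in at y. P z \<noteq> 0"
proof -
  have "linear H" using der has_derivative_linear by blast
  then obtain c where c: "c > 0" "\<And>v. c * norm v \<le> norm (H v)"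
    using inj by (rule injective_linear_bounded_below) blast+
  obtain d where d: "d > 0"
      "\<And>z. norm (z - y) < d \<Longrightarrow> norm (P z - P y - H (z - y)) \<le> c / 2 * norm (z - y)"
    using der c(1) unfolding has_derivative_at_alt by (metis half_gt_zero)
  have "P z \<noteq> 0" if "z \<noteq> y" "dist z y < d" for z
  proof
    assume "P z = 0"
    then have "norm (H (z - y)) \<le> c / 2 * norm (z - y)"
      using d(2)[of z] that \<open>P y = 0\<close> by (simp add: dist_norm)
    with c(2)[of "z - y"] have "c * norm (z - y) \<le> c / 2 * norm (z - y)" by linarith
    with c(1) that(1) show False by simp
  qed
  with d(1) show ?thesis unfolding eventually_at by blast
qed

section \<open>Lipschitz estimates for coefficient functions\<close>

text \<open>
  The operator norm of the derivative is bounded by the sum of the norms of the finitely many partial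
  derivatives, which are continuous on a compact ball.
\<close>

lemma C1_imp_lipschitz_on_cball:
  fixes F :: "'e::finite_dim_inner \<Rightarrow> 'b::real_normed_vector"
  assumes F: "Ck_on (Suc 0) F V" and ball: "cball y r \<subseteq> V"
  obtains L where "L-lipschitz_on (cball y r) F"
proof -
  let ?D = "\<lambda>x. frechet_derivative F (at x)"
  have der: "(F has_derivative ?D x) (at x)" if "x \<in> V" for x
    using F that by (simp add: frechet_derivative_works)
  have cont: "continuous_on (cball y r) (\<lambda>x. ?D x v)" for v
    using F ball by (auto intro: continuous_on_subset)
  obtain B :: "'e set" where B: "finite B" "\<And>x. (\<Sum>b\<in>B. (x \<bullet> b) *\<^sub>R b) = x"
      "\<And>b. b \<in> B \<Longrightarrow> norm b = 1"
    by (rule finite_coordinates) blast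
  have "\<exists>M\<ge>0. \<forall>x\<in>cball y r. norm (?D x v) \<le> M" for v
  proof -
    have "bounded ((\<lambda>x. ?D x v) ` cball y r)"
      by (intro compact_imp_bounded compact_continuous_image cont compact_cball)
    then obtain M where "\<forall>x\<in>cball y r. norm (?D x v) \<le> M"
      unfolding bounded_iff by blast
    then have "\<forall>x\<in>cball y r. norm (?D x v) \<le> max 0 M" by force
    then show ?thesis by (intro exI[of _ "max 0 M"]) simp
  qed
  then obtain M where M: "\<And>v. M v \<ge> 0" "\<And>v x. x \<in> cball y r \<Longrightarrow> norm (?D x v) \<le> M v"
    by metis
  define L where "L = (\<Sum>b\<in>B. M b)"
  have "L \<ge> 0" unfolding L_def by (intro sum_nonneg M)
  have on: "onorm (?D x) \<le> L" if x: "x \<in> cball y r" for x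
  proof (rule onorm_bound[OF \<open>L \<ge> 0\<close>])
    fix v
    interpret D: bounded_linear "?D x"
      using der x ball has_derivative_bounded_linear by blast
    have "?D x v = ?D x (\<Sum>b\<in>B. (v \<bullet> b) *\<^sub>R b)" by (simp add: B(2))
    also have "\<dots> = (\<Sum>b\<in>B. (v \<bullet> b) *\<^sub>R ?D x b)" by (simp add: D.sum D.scaleR)
    also have "norm \<dots> \<le> (\<Sum>b\<in>B. norm v * M b)"
    proof (rule sum_norm_le)
      fix b assume b: "b \<in> B"
      have "\<bar>v \<bullet> b\<bar> \<le> norm v" using Cauchy_Schwarz_ineq2[of v b] B(3)[OF b] by simp
      then show "norm ((v \<bullet> b) *\<^sub>R ?D x b) \<le> norm v * M b"
        using M(2)[OF x, of b] by (simp add: mult_mono)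
    qed
    finally show "norm (?D x v) \<le> L * norm v"
      by (simp add: L_def sum_distrib_left mult.commute)
  qed
  have "L-lipschitz_on (cball y r) F"
  proof (rule lipschitz_onI[OF _ \<open>L \<ge> 0\<close>])
    fix a b assume ab: "a \<in> cball y r" "b \<in> cball y r"
    have "norm (F a - F b) \<le> L * norm (a - b)"
      by (rule differentiable_bound[OF convex_cball _ on ab])
        (use der ball in \<open>blast intro: has_derivative_at_withinI\<close>)
    then show "dist (F a) (F b) \<le> L * dist a b" by (simp add: dist_norm)
  qed
  then show ?thesis by (rule that)
qed

text \<open>
  Lipschitz constants for the finitely many basis vectors add up to a constant that is uniform on the
  unit ball. The next lemma does the same for bilinear forms.
\<close>

lemma linear_family_lipschitz:
  fixes l :: "'e::finite_dim_inner \<Rightarrow> 'e \<Rightarrow> real"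
  assumes lin: "\<And>y. y \<in> K \<Longrightarrow> linear (l y)" and lip: "\<And>e. \<exists>L. L-lipschitz_on K (\<lambda>y. l y e)"
  obtains L where "L \<ge> 0"
    "\<And>y z e. y \<in> K \<Longrightarrow> z \<in> K \<Longrightarrow> \<bar>l y e - l z e\<bar> \<le> L * dist y z * norm e"
proof -
  obtain B :: "'e set" where B: "finite B" "\<And>x. (\<Sum>b\<in>B. (x \<bullet> b) *\<^sub>R b) = x"
      "\<And>b. b \<in> B \<Longrightarrow> norm b = 1"
    by (rule finite_coordinates) blast
  obtain M where M: "\<And>e. (M e)-lipschitz_on K (\<lambda>y. l y e)" using lip by metis
  have expand: "l y e = (\<Sum>b\<in>B. (e \<bullet> b) * l y b)" if "y \<in> K" for y e
  proof -
    interpret l: linear "l y" using that by (rule lin)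
    have "l y e = l y (\<Sum>b\<in>B. (e \<bullet> b) *\<^sub>R b)" by (simp add: B(2))
    then show ?thesis by (simp add: l.sum l.scaleR)
  qed
  show ?thesis
  proof (rule that[of "\<Sum>b\<in>B. M b"])
    show "(\<Sum>b\<in>B. M b) \<ge> 0" by (intro sum_nonneg lipschitz_on_nonneg[OF M])
    fix y z e assume yz: "y \<in> K" "z \<in> K"
    have "\<bar>l y e - l z e\<bar> = \<bar>\<Sum>b\<in>B. (e \<bullet> b) * (l y b - l z b)\<bar>"
      using yz by (simp add: expand sum_subtractf right_diff_distrib)
    also have "\<dots> \<le> (\<Sum>b\<in>B. norm e * (M b * dist y z))"
    proof (rule order_trans[OF sum_abs sum_mono])
      fix b assume b: "b \<in> B"
      have "\<bar>e \<bullet> b\<bar> \<le> norm e" using Cauchy_Schwarz_ineq2[of e b] B(3)[OF b] by simp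
      moreover have "\<bar>l y b - l z b\<bar> \<le> M b * dist y z"
        using lipschitz_onD[OF M yz, of b] by (simp add: dist_real_def)
      ultimately show "\<bar>(e \<bullet> b) * (l y b - l z b)\<bar> \<le> norm e * (M b * dist y z)"
        by (simp add: abs_mult mult_mono)
    qed
    also have "\<dots> = (\<Sum>b\<in>B. M b) * dist y z * norm e"
      by (simp add: sum_distrib_left sum_distrib_right mult_ac)
    finally show "\<bar>l y e - l z e\<bar> \<le> (\<Sum>b\<in>B. M b) * dist y z * norm e" .
  qed
qed

lemma bilinear_family_lipschitz:
  fixes G :: "'e::finite_dim_inner \<Rightarrow> 'e \<Rightarrow> 'e \<Rightarrow> real"
  assumes left: "\<And>y w. y \<in> K \<Longrightarrow> linear (\<lambda>u. G y u w)" and right: "\<And>y u. y \<in> K \<Longrightarrow> linear (G y u)"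
    and lip: "\<And>u w. \<exists>L. L-lipschitz_on K (\<lambda>y. G y u w)"
  obtains L where "L \<ge> 0"
    "\<And>y z u w. y \<in> K \<Longrightarrow> z \<in> K \<Longrightarrow> \<bar>G y u w - G z u w\<bar> \<le> L * dist y z * norm u * norm w"
proof -
  obtain B :: "'e set" where B: "finite B" "\<And>x. (\<Sum>b\<in>B. (x \<bullet> b) *\<^sub>R b) = x"
      "\<And>b. b \<in> B \<Longrightarrow> norm b = 1"
    by (rule finite_coordinates) blast
  have "\<exists>L\<ge>0. \<forall>y\<in>K. \<forall>z\<in>K. \<forall>e. \<bar>G y e w - G z e w\<bar> \<le> L * dist y z * norm e" for w
    by (rule linear_family_lipschitz[of K "\<lambda>y u. G y u w"]) (use left lip in blast)+
  then obtain M where M: "\<And>w. M w \<ge> 0"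
      "\<And>w y z e. y \<in> K \<Longrightarrow> z \<in> K \<Longrightarrow> \<bar>G y e w - G z e w\<bar> \<le> M w * dist y z * norm e"
    by metis
  have expand: "G y u w = (\<Sum>b\<in>B. (w \<bullet> b) * G y u b)" if "y \<in> K" for y u w
  proof -
    interpret l: linear "G y u" using that by (rule right)
    have "G y u w = G y u (\<Sum>b\<in>B. (w \<bullet> b) *\<^sub>R b)" by (simp add: B(2))
    then show ?thesis by (simp add: l.sum l.scaleR)
  qed
  show ?thesis
  proof (rule that[of "\<Sum>b\<in>B. M b"])
    show "(\<Sum>b\<in>B. M b) \<ge> 0" by (intro sum_nonneg M)
    fix y z u w assume yz: "y \<in> K" "z \<in> K"
    have "\<bar>G y u w - G z u w\<bar> = \<bar>\<Sum>b\<in>B. (w \<bullet> b) * (G y u b - G z u b)\<bar>"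
      using yz by (simp add: expand[of _ u w] sum_subtractf right_diff_distrib)
    also have "\<dots> \<le> (\<Sum>b\<in>B. norm w * (M b * dist y z * norm u))"
    proof (rule order_trans[OF sum_abs sum_mono])
      fix b assume b: "b \<in> B"
      have "\<bar>w \<bullet> b\<bar> \<le> norm w" using Cauchy_Schwarz_ineq2[of w b] B(3)[OF b] by simp
      with M(2)[OF yz, of u b] show
        "\<bar>(w \<bullet> b) * (G y u b - G z u b)\<bar> \<le> norm w * (M b * dist y z * norm u)"
        by (simp add: abs_mult mult_mono)
    qed
    also have "\<dots> = (\<Sum>b\<in>B. M b) * dist y z * norm u * norm w"
      by (simp add: sum_distrib_left sum_distrib_right mult_ac)
    finally show "\<bar>G y u w - G z u w\<bar> \<le> (\<Sum>b\<in>B. M b) * dist y z * norm u * norm w" .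
  qed
qed

text \<open>
  By homogeneity it is enough to bound \<open>G y u u\<close> for unit vectors \<open>u\<close>, where it is a positive
  continuous function on a compact set.
\<close>

lemma positive_form_bounded_below:
  fixes G :: "'e::finite_dim_inner \<Rightarrow> 'e \<Rightarrow> 'e \<Rightarrow> real"
  assumes "compact K"
    and left: "\<And>y w. y \<in> K \<Longrightarrow> linear (\<lambda>u. G y u w)" and right: "\<And>y u. y \<in> K \<Longrightarrow> linear (G y u)"
    and lip: "\<And>u w. \<exists>L. L-lipschitz_on K (\<lambda>y. G y u w)"
    and positive: "\<And>y u. y \<in> K \<Longrightarrow> u \<noteq> 0 \<Longrightarrow> G y u u > 0"
  obtains c where "c > 0" "\<And>y u. y \<in> K \<Longrightarrow> c * (norm u)\<^sup>2 \<le> G y u u"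
proof -
  obtain B :: "'e set" where B: "finite B" "\<And>x. (\<Sum>b\<in>B. (x \<bullet> b) *\<^sub>R b) = x"
    by (rule finite_coordinates) blast
  have expand: "G y u u = (\<Sum>b\<in>B. \<Sum>b'\<in>B. (u \<bullet> b) * (u \<bullet> b') * G y b b')" if y: "y \<in> K" for y u
  proof -
    have "G y u u = G y u (\<Sum>b\<in>B. (u \<bullet> b) *\<^sub>R b)" by (simp add: B(2))
    also have "\<dots> = (\<Sum>b'\<in>B. (u \<bullet> b') * G y u b')"
      by (simp add: linear_sum[OF right[OF y]] linear_cmul[OF right[OF y]])
    also have "\<dots> = (\<Sum>b'\<in>B. (u \<bullet> b') * (\<Sum>b\<in>B. (u \<bullet> b) * G y b b'))"
    proof (rule sum.cong[OF refl])
      fix b'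
      have "G y u b' = G y (\<Sum>b\<in>B. (u \<bullet> b) *\<^sub>R b) b'" by (simp add: B(2))
      also have "\<dots> = (\<Sum>b\<in>B. (u \<bullet> b) * G y b b')"
        by (simp add: linear_sum[OF left[OF y]] linear_cmul[OF left[OF y]])
      finally show "(u \<bullet> b') * G y u b' = (u \<bullet> b') * (\<Sum>b\<in>B. (u \<bullet> b) * G y b b')" by simp
    qed
    also have "\<dots> = (\<Sum>b\<in>B. \<Sum>b'\<in>B. (u \<bullet> b) * (u \<bullet> b') * G y b b')"
      by (subst sum.swap) (simp add: sum_distrib_left mult_ac)
    finally show ?thesis .
  qed
  let ?S = "K \<times> sphere (0::'e) 1"
  have scale: "G y u u = (norm u)\<^sup>2 * G y (u /\<^sub>R norm u) (u /\<^sub>R norm u)" if "y \<in> K" for y u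
  proof (cases "u = 0")
    case True
    then show ?thesis using linear_0[OF right[OF that, of u]] by simp
  next
    case False
    then show ?thesis
      by (simp add: linear_cmul[OF left[OF that]] linear_cmul[OF right[OF that]]
          power2_eq_square field_simps)
  qed
  have "continuous_on K (\<lambda>y. G y b b')" for b b'
  proof -
    obtain L where "L-lipschitz_on K (\<lambda>y. G y b b')" using lip by metis
    then show ?thesis by (rule lipschitz_on_continuous_on)
  qed
  then have "continuous_on ?S (\<lambda>p. G (fst p) b b')" for b b'
    by (rule continuous_on_compose2[of K _ _ fst]) (auto intro!: continuous_intros)
  then have "continuous_on ?S (\<lambda>p. \<Sum>b\<in>B. \<Sum>b'\<in>B. (snd p \<bullet> b) * (snd p \<bullet> b') * G (fst p) b b')"
    by (intro continuous_intros)
  then have cont: "continuous_on ?S (\<lambda>p. G (fst p) (snd p) (snd p))"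
    by (rule continuous_on_eq) (auto simp: expand)
  obtain c where c: "c > 0" "\<And>y u. y \<in> K \<Longrightarrow> norm u = 1 \<Longrightarrow> c \<le> G y u u"
  proof (cases "?S = {}")
    case True
    then have "K = {} \<or> (\<forall>u::'e. norm u \<noteq> 1)" by auto
    then show ?thesis by (intro that[of 1]) auto
  next
    case False
    have "compact ?S" by (intro compact_Times \<open>compact K\<close> compact_sphere_finite_dim)
    from continuous_attains_inf[OF this False cont]
    obtain p where p: "p \<in> ?S"
      "\<forall>p'\<in>?S. G (fst p) (snd p) (snd p) \<le> G (fst p') (snd p') (snd p')" by blast
    have "snd p \<noteq> 0" "fst p \<in> K" using p(1) by auto
    then have "G (fst p) (snd p) (snd p) > 0" by (intro positive)
    then show ?thesis
    proof (rule that)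
      fix y u assume "y \<in> K" "norm (u::'e) = 1"
      then have "(y, u) \<in> ?S" by simp
      with p(2) show "G (fst p) (snd p) (snd p) \<le> G y u u" by fastforce
    qed
  qed
  show ?thesis
  proof (rule that[OF c(1)])
    fix y u assume y: "y \<in> K"
    show "c * (norm u)\<^sup>2 \<le> G y u u"
    proof (cases "u = 0")
      case True
      then show ?thesis using linear_0[OF right[OF y, of u]] by simp
    next
      case False
      then have "c \<le> G y (u /\<^sub>R norm u) (u /\<^sub>R norm u)" by (intro c(2) y) simp
      then have "(norm u)\<^sup>2 * c \<le> (norm u)\<^sup>2 * G y (u /\<^sub>R norm u) (u /\<^sub>R norm u)"
        by (rule mult_left_mono) simp
      then show ?thesis using scale[OF y, of u] by (simp only: mult.commute)
    qed
  qed
qed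

text \<open>
  The field \<open>X\<close> that represents the functionals \<open>l\<close> through the forms \<open>G\<close> will be the gradient in
  a chart. With \<open>d = X y - X z\<close> one has
  \<open>G y d d = (l y d - l z d) - (G y (X z) d - G z (X z) d)\<close>, where the left-hand side is at least
  \<open>c * (norm d)\<^sup>2\<close> and the right-hand side at most a multiple of \<open>dist y z * norm d\<close>.
\<close>

lemma represented_field_lipschitz:
  fixes G :: "'e::finite_dim_inner \<Rightarrow> 'e \<Rightarrow> 'e \<Rightarrow> real" and l :: "'e \<Rightarrow> 'e \<Rightarrow> real"
  assumes "compact K"
    and left: "\<And>y w. y \<in> K \<Longrightarrow> linear (\<lambda>u. G y u w)" and right: "\<And>y u. y \<in> K \<Longrightarrow> linear (G y u)"
    and lipG: "\<And>u w. \<exists>L. L-lipschitz_on K (\<lambda>y. G y u w)"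
    and positive: "\<And>y u. y \<in> K \<Longrightarrow> u \<noteq> 0 \<Longrightarrow> G y u u > 0"
    and linl: "\<And>y. y \<in> K \<Longrightarrow> linear (l y)" and lipl: "\<And>w. \<exists>L. L-lipschitz_on K (\<lambda>y. l y w)"
    and rep: "\<And>y w. y \<in> K \<Longrightarrow> G y (X y) w = l y w"
  obtains L where "L-lipschitz_on K X"
proof (cases "K = {}")
  case True
  then show ?thesis by (intro that[of 0]) simp
next
  case False
  then obtain y0 where y0: "y0 \<in> K" by blast
  obtain c where c: "c > 0" "\<And>y u. y \<in> K \<Longrightarrow> c * (norm u)\<^sup>2 \<le> G y u u"
    using positive_form_bounded_below[OF \<open>compact K\<close> left right lipG positive] by blast
  obtain L1 where L1: "L1 \<ge> 0"
    "\<And>y z e. y \<in> K \<Longrightarrow> z \<in> K \<Longrightarrow> \<bar>l y e - l z e\<bar> \<le> L1 * dist y z * norm e"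
    using linear_family_lipschitz[OF linl lipl] by blast
  obtain L2 where L2: "L2 \<ge> 0"
    "\<And>y z u w. y \<in> K \<Longrightarrow> z \<in> K \<Longrightarrow> \<bar>G y u w - G z u w\<bar> \<le> L2 * dist y z * norm u * norm w"
    using bilinear_family_lipschitz[OF left right lipG] by blast
  obtain D where D: "\<And>y. y \<in> K \<Longrightarrow> dist y y0 \<le> D"
    using compact_imp_bounded[OF \<open>compact K\<close>] bounded_any_center[of K y0]
    by (auto simp: dist_commute)
  obtain N where N: "\<And>e. \<bar>l y0 e\<bar> \<le> norm e * N"
    using bounded_linear.bounded[OF linear_bounded_finite_dim[OF linl[OF y0]]] by auto
  define M where "M = N + L1 * D"
  have bound: "norm (X y) \<le> \<bar>M\<bar> / c" if y: "y \<in> K" for y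
  proof -
    have "\<bar>l y e\<bar> \<le> M * norm e" for e
    proof -
      have "\<bar>l y e\<bar> \<le> \<bar>l y0 e\<bar> + \<bar>l y e - l y0 e\<bar>" by linarith
      also have "\<dots> \<le> norm e * N + L1 * dist y y0 * norm e"
        by (intro add_mono N L1 y y0)
      also have "\<dots> \<le> norm e * N + L1 * D * norm e"
        by (intro add_left_mono mult_right_mono mult_left_mono D y L1) simp
      finally show ?thesis by (simp add: M_def algebra_simps)
    qed
    from this[of "X y"] have "c * (norm (X y))\<^sup>2 \<le> M * norm (X y)"
      using c(2)[OF y, of "X y"] rep[OF y, of "X y"] by linarith
    then have "c * norm (X y) \<le> M \<or> norm (X y) = 0"
      by (auto simp: power2_eq_square)
    then show ?thesis using c(1) by (auto simp: field_simps)
  qed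
  define L where "L = (L1 + L2 * (\<bar>M\<bar> / c)) / c"
  have "L-lipschitz_on K X"
  proof (rule lipschitz_onI)
    show "L \<ge> 0" using L1(1) L2(1) c(1) by (simp add: L_def)
    fix y z assume yz: "y \<in> K" "z \<in> K"
    define d where "d = X y - X z"
    have "c * (norm d)\<^sup>2 \<le> G y d d" by (rule c(2)[OF yz(1)])
    also have "G y d d = (l y d - l z d) - (G y (X z) d - G z (X z) d)"
      unfolding d_def by (simp add: linear_diff[OF left[OF yz(1)]] rep yz)
    also have "\<dots> \<le> L1 * dist y z * norm d + L2 * dist y z * norm (X z) * norm d"
      using L1(2)[OF yz, of d] L2(2)[OF yz, of "X z" d] by linarith
    also have "\<dots> \<le> L1 * dist y z * norm d + L2 * dist y z * (\<bar>M\<bar> / c) * norm d"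
    proof (intro add_left_mono mult_right_mono mult_left_mono)
      show "norm (X z) \<le> \<bar>M\<bar> / c"
        by (rule bound[OF yz(2)])
    qed (use L2 in auto)
    also have "\<dots> = c * (L * dist y z) * norm d"
      using c(1) by (simp add: L_def field_simps)
    finally have "c * norm d * norm d \<le> c * (L * dist y z) * norm d"
      by (simp add: power2_eq_square mult.assoc)
    moreover have "0 \<le> L * dist y z" using \<open>L \<ge> 0\<close> by simp
    ultimately have "norm d \<le> L * dist y z"
      using c(1) by (cases "norm d = 0") auto
    then show "dist (X y) (X z) \<le> L * dist y z" by (simp add: d_def dist_norm)
  qed
  then show ?thesis by (rule that)
qed

section \<open>Local solutions of ordinary differential equations\<close>

lemma integral_norm_le:
  fixes g :: "real \<Rightarrow> 'b::banach"
  assumes "a \<le> b" "continuous_on {a..b} g" "\<And>t. t \<in> {a..b} \<Longrightarrow> norm (g t) \<le> C"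
  shows "norm (integral {a..b} g) \<le> C * (b - a)"
proof -
  have "norm (g a) \<le> C" using assms(1,3) by auto
  then have "C \<ge> 0" by (rule order_trans[OF norm_ge_zero])
  moreover have "(g has_integral integral {a..b} g) {a..b}"
    by (intro integrable_integral integrable_continuous_real assms)
  ultimately show ?thesis
    using has_integral_bound_real[of C "{}" g "integral {a..b} g" a b] assms(1,3) by simp
qed

text \<open>
  Picard iteration, for positive and negative times at once. The curves are defined on the whole
  line and are constant outside the time interval; this is what the retraction \<open>cl\<close> of the line to
  \<open>{-h..h}\<close> is for. Integration starts at \<open>- h\<close>, and subtracting the integral up to \<open>0\<close> restores the
  initial value.
\<close>

lemma picard_local_solutions:
  fixes X :: "'b::banach \<Rightarrow> 'b"
  assumes "r > 0" and lip: "L-lipschitz_on (cball y0 (2 * r)) X"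
  obtains h where "h > 0"
    "\<And>y. y \<in> cball y0 r \<Longrightarrow> \<exists>\<eta>. \<eta> 0 = y \<and> (\<forall>t\<in>{-h<..<h}. \<eta> t \<in> cball y0 (2 * r) \<and>
       (\<eta> has_vector_derivative X (\<eta> t)) (at t))"
proof -
  let ?K = "cball y0 (2 * r)"
  have L: "L \<ge> 0" using lip by (rule lipschitz_on_nonneg)
  have contX: "continuous_on ?K X" using lip by (rule lipschitz_on_continuous_on)
  define M where "M = norm (X y0) + L * (2 * r)"
  have M: "norm (X z) \<le> M" if "z \<in> ?K" for z
  proof -
    have "dist (X y0) (X z) \<le> L * dist y0 z"
      using lip that \<open>r > 0\<close> by (intro lipschitz_onD) auto
    also have "\<dots> \<le> L * (2 * r)" using that L by (intro mult_left_mono) auto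
    finally show ?thesis
      unfolding M_def dist_norm using norm_triangle_sub[of "X z" "X y0"] by (simp add: norm_minus_commute)
  qed
  have "M \<ge> 0" using L \<open>r > 0\<close> by (simp add: M_def)
  \<comment> \<open>the integrals up to \<open>cl t\<close> and up to \<open>0\<close> have length at most \<open>2 * h\<close> and \<open>h\<close>, whence the factors \<open>3 * h\<close> below\<close>
  define h where "h = min (r / (3 * M + 1)) (1 / (6 * L + 1))"
  have h: "h > 0" "3 * M * h \<le> r" "3 * L * h < 1"
  proof -
    show "h > 0" using \<open>M \<ge> 0\<close> L \<open>r > 0\<close> by (simp add: h_def)
    have "h * (3 * M + 1) \<le> r"
      using \<open>M \<ge> 0\<close> pos_le_divide_eq[of "3 * M + 1" h r] by (simp add: h_def)
    with \<open>h > 0\<close> show "3 * M * h \<le> r" by (simp add: algebra_simps)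
    have "h * (6 * L + 1) \<le> 1"
      using L pos_le_divide_eq[of "6 * L + 1" h 1] by (simp add: h_def)
    moreover have "h * (6 * L + 1) = 2 * (3 * L * h) + h" by (simp add: algebra_simps)
    ultimately show "3 * L * h < 1" using \<open>h > 0\<close> L by simp
  qed
  define cl where "cl t = max (-h) (min h t)" for t
  have cl: "cl t \<in> {-h..h}" for t using h(1) by (auto simp: cl_def)
  have cont_cl: "continuous_on S cl" for S unfolding cl_def by (intro continuous_intros)
  have "\<exists>\<eta>. \<eta> 0 = y \<and> (\<forall>t\<in>{-h<..<h}. \<eta> t \<in> ?K \<and> (\<eta> has_vector_derivative X (\<eta> t)) (at t))"
    if y: "y \<in> cball y0 r" for y
  proof -
    let ?S = "PiC (UNIV :: real set) (\<lambda>_. ?K)"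
    define J where "J \<gamma> t = integral {-h..t} (\<lambda>s. X (\<gamma> s))" for \<gamma> :: "real \<Rightarrow> 'b" and t
    define T where "T \<gamma> t = y + (J \<gamma> (cl t) - J \<gamma> 0)" for \<gamma> t
    have in_K: "apply_bcontfun \<gamma> s \<in> ?K" if "\<gamma> \<in> ?S" for \<gamma> s
      using that by (auto simp: mem_PiC_iff)
    have cont_X\<gamma>: "continuous_on I (\<lambda>s. X (apply_bcontfun \<gamma> s))" if "\<gamma> \<in> ?S" for \<gamma> I
      by (rule continuous_on_compose2[OF contX]) (use in_K[OF that] in auto)
    have J_bound: "norm (J \<gamma> t - J \<gamma> 0) \<le> C * (3 * h)"
      if "continuous_on UNIV (\<lambda>s. X (\<gamma> s))" "\<And>s. norm (X (\<gamma> s)) \<le> C" "t \<in> {-h..h}" for \<gamma> t C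
    proof -
      have "C \<ge> 0" by (rule order_trans[OF norm_ge_zero that(2)])
      have J: "norm (J \<gamma> t) \<le> C * (t - (-h))" if "t \<in> {-h..h}" for t
        unfolding J_def
        by (rule integral_norm_le)
          (use \<open>continuous_on UNIV (\<lambda>s. X (\<gamma> s))\<close> \<open>\<And>s. norm (X (\<gamma> s)) \<le> C\<close> that
            in \<open>auto intro: continuous_on_subset\<close>)
      have "norm (J \<gamma> t - J \<gamma> 0) \<le> C * (t - (-h)) + C * (0 - (-h))"
        by (rule order_trans[OF norm_triangle_ineq4 add_mono]; rule J) (use that h(1) in auto)
      also have "\<dots> \<le> C * (3 * h)"
      proof -
        have "C * t \<le> C * h" using that(3) \<open>C \<ge> 0\<close> by (intro mult_left_mono) auto
        then show ?thesis by (simp add: algebra_simps)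
      qed
      finally show ?thesis .
    qed
    have J_diff: "norm ((J \<gamma> t - J \<gamma> 0) - (J \<delta> t - J \<delta> 0)) \<le> C * (3 * h)"
      if "continuous_on UNIV (\<lambda>s. X (\<gamma> s))" "continuous_on UNIV (\<lambda>s. X (\<delta> s))"
        "\<And>s. norm (X (\<gamma> s) - X (\<delta> s)) \<le> C" "t \<in> {-h..h}" for \<gamma> \<delta> t C
    proof -
      have "C \<ge> 0" by (rule order_trans[OF norm_ge_zero that(3)])
      have J: "norm (J \<gamma> t - J \<delta> t) \<le> C * (t - (-h))" if "t \<in> {-h..h}" for t
      proof -
        have "J \<gamma> t - J \<delta> t = integral {-h..t} (\<lambda>s. X (\<gamma> s) - X (\<delta> s))"
          unfolding J_def
          by (rule integral_diff[symmetric]; rule integrable_continuous_real)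
            (use \<open>continuous_on UNIV (\<lambda>s. X (\<gamma> s))\<close> \<open>continuous_on UNIV (\<lambda>s. X (\<delta> s))\<close>
              in \<open>auto intro: continuous_on_subset\<close>)
        also have "norm \<dots> \<le> C * (t - (-h))"
          by (rule integral_norm_le)
            (use \<open>continuous_on UNIV (\<lambda>s. X (\<gamma> s))\<close> \<open>continuous_on UNIV (\<lambda>s. X (\<delta> s))\<close>
              \<open>\<And>s. norm (X (\<gamma> s) - X (\<delta> s)) \<le> C\<close> that
              in \<open>auto intro!: continuous_intros intro: continuous_on_subset\<close>)
        finally show ?thesis .
      qed
      have "norm ((J \<gamma> t - J \<gamma> 0) - (J \<delta> t - J \<delta> 0)) = norm ((J \<gamma> t - J \<delta> t) - (J \<gamma> 0 - J \<delta> 0))"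
        by (simp add: algebra_simps)
      also have "\<dots> \<le> C * (t - (-h)) + C * (0 - (-h))"
        by (rule order_trans[OF norm_triangle_ineq4 add_mono]; rule J) (use that h(1) in auto)
      also have "\<dots> \<le> C * (3 * h)"
      proof -
        have "C * t \<le> C * h" using that(4) \<open>C \<ge> 0\<close> by (intro mult_left_mono) auto
        then show ?thesis by (simp add: algebra_simps)
      qed
      finally show ?thesis .
    qed
    have T_cont: "continuous_on UNIV (T (apply_bcontfun \<gamma>))" if "\<gamma> \<in> ?S" for \<gamma>
    proof -
      have "continuous_on {-h..h} (J (apply_bcontfun \<gamma>))"
        unfolding J_def by (intro indefinite_integral_continuous_1 integrable_continuous_real cont_X\<gamma> that)
      then have "continuous_on UNIV (\<lambda>t. J (apply_bcontfun \<gamma>) (cl t))"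
        by (rule continuous_on_compose2[OF _ cont_cl]) (use cl in auto)
      then show ?thesis unfolding T_def by (intro continuous_intros)
    qed
    have T_ball: "T (apply_bcontfun \<gamma>) t \<in> ?K" if \<gamma>: "\<gamma> \<in> ?S" for \<gamma> t
    proof -
      have "norm (J (apply_bcontfun \<gamma>) (cl t) - J (apply_bcontfun \<gamma>) 0) \<le> M * (3 * h)"
        by (rule J_bound[OF cont_X\<gamma>[OF \<gamma>] M[OF in_K[OF \<gamma>]] cl])
      then have "dist y (T (apply_bcontfun \<gamma>) t) \<le> r"
        using h(2) by (simp add: T_def dist_norm norm_minus_commute mult_ac)
      moreover have "dist y0 (T (apply_bcontfun \<gamma>) t) \<le> dist y0 y + dist y (T (apply_bcontfun \<gamma>) t)"
        by (rule dist_triangle)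
      ultimately show ?thesis using y by simp
    qed
    have T_bcont: "T (apply_bcontfun \<gamma>) \<in> bcontfun" if "\<gamma> \<in> ?S" for \<gamma>
      using T_cont[OF that] T_ball[OF that]
      by (auto simp: bcontfun_def intro!: bounded_subset[OF bounded_cball[of y0 "2 * r"]])
    define TT where "TT \<gamma> = Bcontfun (T (apply_bcontfun \<gamma>))" for \<gamma>
    have TT: "apply_bcontfun (TT \<gamma>) = T (apply_bcontfun \<gamma>)" if "\<gamma> \<in> ?S" for \<gamma>
      unfolding TT_def by (rule Bcontfun_inverse[OF T_bcont[OF that]])
    have "\<exists>!\<gamma>\<in>?S. TT \<gamma> = \<gamma>"
    proof (rule Banach_fix[where c = "3 * L * h"])
      show "complete ?S" by (simp add: complete_eq_closed closed_PiC)
      have "const_bcontfun y0 \<in> ?S" using \<open>r > 0\<close> by (simp add: mem_PiC_iff const_bcontfun.rep_eq)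
      then show "?S \<noteq> {}" by blast
      show "0 \<le> 3 * L * h" using L h(1) by simp
      show "3 * L * h < 1" by (rule h)
      show "TT ` ?S \<subseteq> ?S" using T_ball by (auto simp: mem_PiC_iff TT Pi_iff)
      fix \<gamma> \<delta> assume \<gamma>: "\<gamma> \<in> ?S" and \<delta>: "\<delta> \<in> ?S"
      show "dist (TT \<gamma>) (TT \<delta>) \<le> 3 * L * h * dist \<gamma> \<delta>"
      proof (rule dist_bound)
        fix t
        have "norm (X (apply_bcontfun \<gamma> s) - X (apply_bcontfun \<delta> s)) \<le> L * dist \<gamma> \<delta>" for s
        proof -
          have "dist (X (apply_bcontfun \<gamma> s)) (X (apply_bcontfun \<delta> s))
              \<le> L * dist (apply_bcontfun \<gamma> s) (apply_bcontfun \<delta> s)"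
            by (rule lipschitz_onD[OF lip]) (use in_K \<gamma> \<delta> in auto)
          also have "\<dots> \<le> L * dist \<gamma> \<delta>" by (intro mult_left_mono dist_bounded L)
          finally show ?thesis by (simp add: dist_norm)
        qed
        from J_diff[OF cont_X\<gamma>[OF \<gamma>] cont_X\<gamma>[OF \<delta>] this cl[of t]]
        show "dist (apply_bcontfun (TT \<gamma>) t) (apply_bcontfun (TT \<delta>) t) \<le> 3 * L * h * dist \<gamma> \<delta>"
          by (simp add: TT[OF \<gamma>] TT[OF \<delta>] T_def dist_norm mult_ac)
      qed
    qed
    then obtain \<gamma> where \<gamma>: "\<gamma> \<in> ?S" "TT \<gamma> = \<gamma>" by blast
    define \<eta> where "\<eta> = apply_bcontfun \<gamma>"
    have fix_eq: "\<eta> t = y + (J \<eta> (cl t) - J \<eta> 0)" for t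
      using TT[OF \<gamma>(1)] \<gamma>(2) by (simp add: \<eta>_def T_def fun_eq_iff)
    have "(\<eta> has_vector_derivative X (\<eta> t)) (at t)" if t: "t \<in> {-h<..<h}" for t
    proof -
      have "(J \<eta> has_vector_derivative X (\<eta> t)) (at t within {-h..h})"
        unfolding J_def
        by (rule integral_has_vector_derivative) (use t cont_X\<gamma>[OF \<gamma>(1)] in \<open>auto simp: \<eta>_def\<close>)
      then have "(J \<eta> has_vector_derivative X (\<eta> t)) (at t)"
        using t at_within_Icc_at[of "-h" t h] by auto
      then have "((\<lambda>t. y + (J \<eta> t - J \<eta> 0)) has_vector_derivative X (\<eta> t)) (at t)"
        by (auto intro!: derivative_eq_intros)
      then show ?thesis
        by (rule has_vector_derivative_transform_within_open[where S = "{-h<..<h}"])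
          (use t in \<open>auto simp: fix_eq cl_def\<close>)
    qed
    moreover have "\<eta> 0 = y" using h(1) by (simp add: fix_eq cl_def)
    moreover have "\<eta> t \<in> ?K" for t using in_K[OF \<gamma>(1)] by (simp add: \<eta>_def)
    ultimately show ?thesis by blast
  qed
  with h(1) show ?thesis by (rule that)
qed

text \<open>
  The squared distance \<open>u\<close> of two solutions satisfies \<open>\<bar>u'\<bar> \<le> 2 * L * u\<close>, so that \<open>u\<close> is
  non-increasing after multiplication by \<open>exp (- 2 * L * t)\<close> and non-decreasing after
  multiplication by \<open>exp (2 * L * t)\<close>. The first fact gives the estimate forward in time, the second
  one backward.
\<close>

lemma lipschitz_curves_norm_le:
  fixes \<gamma> \<delta> :: "real \<Rightarrow> 'b::real_inner"
  assumes lip: "L-lipschitz_on S X"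
    and \<gamma>: "\<And>t. t \<in> {a<..<b} \<Longrightarrow> \<gamma> t \<in> S \<and> (\<gamma> has_vector_derivative X (\<gamma> t)) (at t)"
    and \<delta>: "\<And>t. t \<in> {a<..<b} \<Longrightarrow> \<delta> t \<in> S \<and> (\<delta> has_vector_derivative X (\<delta> t)) (at t)"
    and s: "s \<in> {a<..<b}" and t: "t \<in> {a<..<b}"
  shows "norm (\<gamma> t - \<delta> t) \<le> exp (L * \<bar>t - s\<bar>) * norm (\<gamma> s - \<delta> s)"
proof -
  define u where "u t = (norm (\<gamma> t - \<delta> t))\<^sup>2" for t
  define u' where "u' t = 2 * ((\<gamma> t - \<delta> t) \<bullet> (X (\<gamma> t) - X (\<delta> t)))" for t
  have du: "(u has_real_derivative u' t) (at t)" if "t \<in> {a<..<b}" for t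
  proof -
    have "((\<lambda>t. \<gamma> t - \<delta> t) has_vector_derivative (X (\<gamma> t) - X (\<delta> t))) (at t)"
      using \<gamma> \<delta> that by (intro has_vector_derivative_diff) auto
    then have "((\<lambda>t. \<gamma> t - \<delta> t) has_derivative (\<lambda>h. h *\<^sub>R (X (\<gamma> t) - X (\<delta> t)))) (at t)"
      by (simp add: has_vector_derivative_def)
    from has_derivative_inner[OF this this]
    have "((\<lambda>t. (\<gamma> t - \<delta> t) \<bullet> (\<gamma> t - \<delta> t)) has_derivative (\<lambda>h. u' t * h)) (at t)"
      by (rule has_derivative_eq_rhs) (auto simp: u'_def inner_commute algebra_simps)
    moreover have "u = (\<lambda>t. (\<gamma> t - \<delta> t) \<bullet> (\<gamma> t - \<delta> t))"
      by (simp add: u_def fun_eq_iff power2_norm_eq_inner)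
    ultimately show ?thesis by (simp add: has_field_derivative_def)
  qed
  have u'_le: "\<bar>u' t\<bar> \<le> 2 * L * u t" if "t \<in> {a<..<b}" for t
  proof -
    have "\<bar>(\<gamma> t - \<delta> t) \<bullet> (X (\<gamma> t) - X (\<delta> t))\<bar> \<le> norm (\<gamma> t - \<delta> t) * norm (X (\<gamma> t) - X (\<delta> t))"
      by (rule Cauchy_Schwarz_ineq2)
    also have "\<dots> \<le> norm (\<gamma> t - \<delta> t) * (L * norm (\<gamma> t - \<delta> t))"
      using lipschitz_onD[OF lip, of "\<gamma> t" "\<delta> t"] \<gamma> \<delta> that
      by (intro mult_left_mono) (auto simp: dist_norm)
    finally show ?thesis by (simp add: u'_def u_def power2_eq_square abs_mult algebra_simps)
  qed
  have down: "u t * exp (- 2 * L * t) \<le> u s * exp (- 2 * L * s)"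
    if "s \<le> t" "s \<in> {a<..<b}" "t \<in> {a<..<b}" for s t
  proof (rule DERIV_nonpos_imp_nonincreasing[OF that(1)])
    fix x assume "s \<le> x" "x \<le> t"
    with that have x: "x \<in> {a<..<b}" by auto
    have "((\<lambda>x. u x * exp (- 2 * L * x)) has_real_derivative
        (u' x - 2 * L * u x) * exp (- 2 * L * x)) (at x)"
      by (auto intro!: derivative_eq_intros du[OF x] simp: algebra_simps)
    moreover have "(u' x - 2 * L * u x) * exp (- 2 * L * x) \<le> 0"
      using u'_le[OF x] by (intro mult_nonpos_nonneg) auto
    ultimately show "\<exists>y. ((\<lambda>x. u x * exp (- 2 * L * x)) has_real_derivative y) (at x) \<and> y \<le> 0"
      by blast
  qed
  have up: "u s * exp (2 * L * s) \<le> u t * exp (2 * L * t)"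
    if "s \<le> t" "s \<in> {a<..<b}" "t \<in> {a<..<b}" for s t
  proof (rule DERIV_nonneg_imp_nondecreasing[OF that(1)])
    fix x assume "s \<le> x" "x \<le> t"
    with that have x: "x \<in> {a<..<b}" by auto
    have "((\<lambda>x. u x * exp (2 * L * x)) has_real_derivative
        (u' x + 2 * L * u x) * exp (2 * L * x)) (at x)"
      by (auto intro!: derivative_eq_intros du[OF x] simp: algebra_simps)
    moreover have "(u' x + 2 * L * u x) * exp (2 * L * x) \<ge> 0"
      using u'_le[OF x] by (intro mult_nonneg_nonneg) auto
    ultimately show "\<exists>y. ((\<lambda>x. u x * exp (2 * L * x)) has_real_derivative y) (at x) \<and> 0 \<le> y"
      by blast
  qed
  have "u t \<le> u s * exp (2 * L * \<bar>t - s\<bar>)"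
  proof (cases "s \<le> t")
    case True
    have "u t = u t * exp (- 2 * L * t) * exp (2 * L * t)" by (simp add: exp_minus field_simps)
    also have "\<dots> \<le> u s * exp (- 2 * L * s) * exp (2 * L * t)"
      using down[OF True s t] by (rule mult_right_mono) simp
    also have "\<dots> = u s * exp (2 * L * \<bar>t - s\<bar>)"
      using True by (simp add: mult.assoc exp_add[symmetric] right_diff_distrib)
    finally show ?thesis .
  next
    case False
    then have "t \<le> s" by simp
    have "u t = u t * exp (2 * L * t) * exp (- 2 * L * t)" by (simp add: exp_minus field_simps)
    also have "\<dots> \<le> u s * exp (2 * L * s) * exp (- 2 * L * t)"
      using up[OF \<open>t \<le> s\<close> t s] by (rule mult_right_mono) simp
    also have "\<dots> = u s * exp (2 * L * \<bar>t - s\<bar>)"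
      using False by (simp add: mult.assoc exp_add[symmetric] right_diff_distrib)
    finally show ?thesis .
  qed
  also have "\<dots> = (exp (L * \<bar>t - s\<bar>) * norm (\<gamma> s - \<delta> s))\<^sup>2"
    by (simp add: u_def power_mult_distrib exp_double[symmetric] mult_ac)
  finally show ?thesis
    unfolding u_def by (rule power2_le_imp_le) simp
qed

section \<open>Gradients in charts\<close>

lemma smooth_on_has_derivative:
  assumes "smooth_on F S" and "x \<in> S"
  shows "(F has_derivative frechet_derivative F (at x)) (at x)"
proof -
  have "Ck_on (Suc 0) F S" using assms(1) unfolding smooth_on_def by blast
  with assms(2) show ?thesis by (simp add: frechet_derivative_works)
qed

locale riemannian_function =
  fixes A :: "('a::{t2_space, second_countable_topology}, 'e::finite_dim_inner) chart set"
    and g :: "'a \<Rightarrow> ('a, 'e) tvec \<Rightarrow> ('a, 'e) tvec \<Rightarrow> real"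
    and f :: "'a \<Rightarrow> real"
  assumes atlas: "smooth_atlas A"
    and metric: "riemannian_metric A g"
    and smooth_f: "smooth_function A f"
begin

abbreviation chart_image :: "('a, 'e) chart \<Rightarrow> 'e set" where
  "chart_image c \<equiv> snd c ` fst c"

lemma chart:
  assumes "c \<in> A"
  shows open_domain: "open (fst c)" and open_image: "open (chart_image c)"
    and continuous_chart: "continuous_on (fst c) (snd c)"
    and continuous_chart_inv: "continuous_on (chart_image c) (chart_inv c)"
    and chart_inv_chart: "p \<in> fst c \<Longrightarrow> chart_inv c (snd c p) = p"
proof -
  have "is_chart c" using atlas assms by (simp add: smooth_atlas_def)
  then show "open (fst c)" "open (chart_image c)" "continuous_on (fst c) (snd c)"
      "continuous_on (chart_image c) (chart_inv c)" "p \<in> fst c \<Longrightarrow> chart_inv c (snd c p) = p"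
    by (auto simp: is_chart_def homeomorphism_def)
qed

lemma chart_inv_image:
  assumes "c \<in> A" "y \<in> chart_image c"
  shows "chart_inv c y \<in> fst c" and "snd c (chart_inv c y) = y"
proof -
  obtain p where p: "p \<in> fst c" "y = snd c p" using assms(2) by blast
  then show "chart_inv c y \<in> fst c" "snd c (chart_inv c y) = y"
    using chart_inv_chart[OF assms(1) p(1)] by simp_all
qed

lemma chart_exists: obtains c where "c \<in> A" "p \<in> fst c"
proof -
  have "p \<in> (\<Union>c\<in>A. fst c)" using atlas by (simp add: smooth_atlas_def)
  then show ?thesis using that by blast
qed

lemma isCont_chart:
  assumes "c \<in> A" "p \<in> fst c"
  shows "isCont (snd c) p"
proof -
  have "\<forall>p\<in>fst c. isCont (snd c) p"
    using continuous_chart[OF assms(1)]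
    by (simp only: continuous_on_eq_continuous_at[OF open_domain[OF assms(1)]])
  then show ?thesis using assms(2) by (rule bspec)
qed

lemma isCont_chart_inv:
  assumes "c \<in> A" "y \<in> chart_image c"
  shows "isCont (chart_inv c) y"
proof -
  have "\<forall>y\<in>chart_image c. isCont (chart_inv c) y"
    using continuous_chart_inv[OF assms(1)]
    by (simp only: continuous_on_eq_continuous_at[OF open_image[OF assms(1)]])
  then show ?thesis using assms(2) by (rule bspec)
qed

lemma overlap_image:
  assumes "c \<in> A"
  shows "snd c ` (fst c \<inter> U) = chart_image c \<inter> chart_inv c -` U"
proof -
  have "chart_inv c (snd c p) = p" if "p \<in> fst c" for p
    using assms that by (rule chart_inv_chart)
  then show ?thesis by (auto simp: image_iff)
qed

lemma open_overlap_image: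
  assumes "c \<in> A" "open U"
  shows "open (snd c ` (fst c \<inter> U))"
  unfolding overlap_image[OF assms(1)]
  by (intro continuous_open_preimage continuous_chart_inv open_image assms)

lemma open_chart_preimage:
  assumes "c \<in> A" "open W"
  shows "open (fst c \<inter> snd c -` W)"
  by (intro continuous_open_preimage continuous_chart open_domain assms)

definition transition_derivative :: "('a, 'e) chart \<Rightarrow> ('a, 'e) chart \<Rightarrow> 'a \<Rightarrow> 'e \<Rightarrow> 'e" where
  "transition_derivative c d p = frechet_derivative (snd d \<circ> chart_inv c) (at (snd c p))"

lemma has_transition_derivative:
  assumes "c \<in> A" "d \<in> A" "p \<in> fst c" "p \<in> fst d"
  shows "((snd d \<circ> chart_inv c) has_derivative transition_derivative c d p) (at (snd c p))"
  unfolding transition_derivative_def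
proof (rule smooth_on_has_derivative)
  show "smooth_on (snd d \<circ> chart_inv c) (snd c ` (fst c \<inter> fst d))"
    using atlas assms by (simp add: smooth_atlas_def)
  show "snd c p \<in> snd c ` (fst c \<inter> fst d)" using assms by blast
qed

lemma linear_transition_derivative:
  assumes "c \<in> A" "d \<in> A" "p \<in> fst c" "p \<in> fst d"
  shows "linear (transition_derivative c d p)"
  using has_derivative_linear[OF has_transition_derivative[OF assms]] .

lemma transition_derivative_chain:
  assumes "c \<in> A" "d \<in> A" "d' \<in> A" "p \<in> fst c" "p \<in> fst d" "p \<in> fst d'"
  shows "transition_derivative d d' p (transition_derivative c d p v) = transition_derivative c d' p v"
proof -
  have "((snd d' \<circ> chart_inv d) \<circ> (snd d \<circ> chart_inv c) has_derivative
      transition_derivative d d' p \<circ> transition_derivative c d p) (at (snd c p))"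
    by (rule diff_chain_at[OF has_transition_derivative[OF assms(1,2,4,5)]])
      (use has_transition_derivative[OF assms(2,3,5,6)] assms in \<open>simp add: chart_inv_chart\<close>)
  then have "((snd d' \<circ> chart_inv c) has_derivative
      transition_derivative d d' p \<circ> transition_derivative c d p) (at (snd c p))"
  proof (rule has_derivative_transform_within_open)
    show "open (snd c ` (fst c \<inter> fst d))" using assms by (intro open_overlap_image open_domain)
    show "snd c p \<in> snd c ` (fst c \<inter> fst d)" using assms by blast
    show "((snd d' \<circ> chart_inv d) \<circ> (snd d \<circ> chart_inv c)) y = (snd d' \<circ> chart_inv c) y"
      if "y \<in> snd c ` (fst c \<inter> fst d)" for y
      using that chart_inv_chart[OF assms(1)] chart_inv_chart[OF assms(2)] by auto
  qed
  from has_derivative_unique[OF this has_transition_derivative[OF assms(1,3,4,6)]]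
  show ?thesis by (simp add: fun_eq_iff)
qed

lemma transition_derivative_self:
  assumes "c \<in> A" "p \<in> fst c"
  shows "transition_derivative c c p v = v"
proof -
  have "((\<lambda>y. y) has_derivative (\<lambda>v. v)) (at (snd c p))" by (rule has_derivative_ident)
  then have "((snd c \<circ> chart_inv c) has_derivative (\<lambda>v. v)) (at (snd c p))"
    by (rule has_derivative_transform_within_open[OF _ open_image[OF assms(1)]])
      (use assms chart_inv_image(2)[OF assms(1)] in \<open>simp_all add: o_def\<close>)
  from has_derivative_unique[OF this has_transition_derivative[OF assms(1,1,2,2)]]
  show ?thesis by (simp add: fun_eq_iff)
qed

lemma coord_vector_component:
  "c \<in> A \<Longrightarrow> d \<in> A \<Longrightarrow> p \<in> fst d \<Longrightarrow> coord_vector A c p e d = transition_derivative c d p e"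
  by (simp add: coord_vector_def transition_derivative_def)

lemma coord_vector_outside: "\<not> (d \<in> A \<and> p \<in> fst d) \<Longrightarrow> coord_vector A c p e d = 0"
  unfolding coord_vector_def by (rule if_not_P)

lemma coord_vector_in_tangent_space:
  assumes "c \<in> A" "p \<in> fst c"
  shows "coord_vector A c p e \<in> tangent_space A p"
  unfolding tangent_space_def mem_Collect_eq
proof (intro conjI allI impI ballI)
  fix d assume "\<not> (d \<in> A \<and> p \<in> fst d)"
  then show "coord_vector A c p e d = 0" by (rule coord_vector_outside)
next
  fix d d' assume "d \<in> A" "d' \<in> A" "p \<in> fst d \<and> p \<in> fst d'"
  then show "coord_vector A c p e d' =
      frechet_derivative (snd d' \<circ> chart_inv d) (at (snd d p)) (coord_vector A c p e d)"
    using assms transition_derivative_chain[of c d d' p e]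
    by (simp add: coord_vector_component transition_derivative_def)
qed

lemma coord_vector_self: "c \<in> A \<Longrightarrow> p \<in> fst c \<Longrightarrow> coord_vector A c p e c = e"
  by (simp add: coord_vector_component transition_derivative_self)

lemma tangent_component:
  assumes "v \<in> tangent_space A p" "c \<in> A" "d \<in> A" "p \<in> fst c" "p \<in> fst d"
  shows "v d = transition_derivative c d p (v c)"
  using assms unfolding tangent_space_def mem_Collect_eq transition_derivative_def by blast

lemma coord_vector_tangent:
  assumes "c \<in> A" "p \<in> fst c" "v \<in> tangent_space A p"
  shows "coord_vector A c p (v c) = v"
proof
  fix d
  show "coord_vector A c p (v c) d = v d"
  proof (cases "d \<in> A \<and> p \<in> fst d")
    case True
    then show ?thesis
      using assms tangent_component[of v p c d] by (simp add: coord_vector_component)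
  next
    case False
    moreover have "v d = 0" using assms(3) False unfolding tangent_space_def mem_Collect_eq by blast
    ultimately show ?thesis by (simp add: coord_vector_outside)
  qed
qed

lemma coord_vector_linear:
  assumes "c \<in> A" "p \<in> fst c"
  shows "coord_vector A c p (r *\<^sub>R e + e') = (\<lambda>d. r *\<^sub>R coord_vector A c p e d + coord_vector A c p e' d)"
proof
  fix d
  show "coord_vector A c p (r *\<^sub>R e + e') d = r *\<^sub>R coord_vector A c p e d + coord_vector A c p e' d"
  proof (cases "d \<in> A \<and> p \<in> fst d")
    case True
    then have "linear (transition_derivative c d p)"
      using assms by (intro linear_transition_derivative) auto
    with True assms show ?thesis
      by (simp add: coord_vector_component linear_add linear_cmul)
  qed (simp add: coord_vector_outside)
qed

definition chart_metric :: "('a, 'e) chart \<Rightarrow> 'e \<Rightarrow> 'e \<Rightarrow> 'e \<Rightarrow> real" where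
  "chart_metric c y e e' =
     g (chart_inv c y) (coord_vector A c (chart_inv c y) e) (coord_vector A c (chart_inv c y) e')"

lemma metric_linear_left:
  assumes "u \<in> tangent_space A p" "v \<in> tangent_space A p" "w \<in> tangent_space A p"
  shows "g p (\<lambda>c. r *\<^sub>R u c + v c) w = r * g p u w + g p v w"
  by (rule metric[unfolded riemannian_metric_def, THEN conjunct1, rule_format, OF assms])

lemma metric_sym: "u \<in> tangent_space A p \<Longrightarrow> v \<in> tangent_space A p \<Longrightarrow> g p u v = g p v u"
  by (rule metric[unfolded riemannian_metric_def, THEN conjunct2, THEN conjunct1, rule_format])

lemma metric_pos: "u \<in> tangent_space A p \<Longrightarrow> u \<noteq> (\<lambda>c. 0) \<Longrightarrow> g p u u > 0"
  by (rule metric[unfolded riemannian_metric_def, THEN conjunct2, THEN conjunct2, THEN conjunct1,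
        rule_format])

lemma chart_metric_smooth: "c \<in> A \<Longrightarrow> smooth_on (\<lambda>y. chart_metric c y e e') (chart_image c)"
  using metric[unfolded riemannian_metric_def, THEN conjunct2, THEN conjunct2, THEN conjunct2]
  unfolding chart_metric_def by blast

lemma chart_metric_sym:
  assumes "c \<in> A" "y \<in> chart_image c"
  shows "chart_metric c y e e' = chart_metric c y e' e"
  unfolding chart_metric_def
  using assms by (intro metric_sym coord_vector_in_tangent_space chart_inv_image)

lemma chart_metric_linear:
  assumes "c \<in> A" "y \<in> chart_image c"
  shows chart_metric_linear_left: "linear (\<lambda>u. chart_metric c y u w)"
    and chart_metric_linear_right: "linear (chart_metric c y u)"
proof -
  let ?p = "chart_inv c y"
  have p: "?p \<in> fst c" using assms by (rule chart_inv_image)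
  show left: "linear (\<lambda>u. chart_metric c y u w)" for w
    unfolding chart_metric_def
    by (rule linearI_combination)
      (simp add: coord_vector_linear metric_linear_left coord_vector_in_tangent_space assms p)
  have "chart_metric c y u = (\<lambda>w. chart_metric c y w u)"
    using chart_metric_sym[OF assms] by blast
  with left[of u] show "linear (chart_metric c y u)" by simp
qed

lemma chart_metric_pos:
  assumes "c \<in> A" "y \<in> chart_image c" "u \<noteq> 0"
  shows "chart_metric c y u u > 0"
proof -
  let ?p = "chart_inv c y"
  have p: "?p \<in> fst c" using assms by (intro chart_inv_image)
  show ?thesis
    unfolding chart_metric_def
  proof (rule metric_pos)
    show "coord_vector A c ?p u \<in> tangent_space A ?p"
      using assms p by (intro coord_vector_in_tangent_space)
    show "coord_vector A c ?p u \<noteq> (\<lambda>c. 0)"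
      using coord_vector_self[OF assms(1) p, of u] assms(3) by auto
  qed
qed

abbreviation local_f :: "('a, 'e) chart \<Rightarrow> 'e \<Rightarrow> real" where
  "local_f c \<equiv> f \<circ> chart_inv c"

abbreviation local_df :: "('a, 'e) chart \<Rightarrow> 'e \<Rightarrow> 'e \<Rightarrow> real" where
  "local_df c y \<equiv> frechet_derivative (local_f c) (at y)"

lemma smooth_local_f: "c \<in> A \<Longrightarrow> smooth_on (local_f c) (chart_image c)"
  using smooth_f unfolding smooth_function_def by (rule bspec)

lemma has_local_df:
  "c \<in> A \<Longrightarrow> y \<in> chart_image c \<Longrightarrow> (local_f c has_derivative local_df c y) (at y)"
  by (rule smooth_on_has_derivative[OF smooth_local_f])

lemma linear_local_df: "c \<in> A \<Longrightarrow> y \<in> chart_image c \<Longrightarrow> linear (local_df c y)"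
  using has_derivative_linear[OF has_local_df] .

lemma local_df_transition:
  assumes "c \<in> A" "d \<in> A" "p \<in> fst c" "p \<in> fst d"
  shows "local_df d (snd d p) (transition_derivative c d p v) = local_df c (snd c p) v"
proof -
  have "(local_f d \<circ> (snd d \<circ> chart_inv c) has_derivative
      local_df d (snd d p) \<circ> transition_derivative c d p) (at (snd c p))"
    by (rule diff_chain_at[OF has_transition_derivative[OF assms]])
      (use has_local_df[of d "snd d p"] assms in \<open>simp add: chart_inv_chart\<close>)
  then have "(local_f c has_derivative
      local_df d (snd d p) \<circ> transition_derivative c d p) (at (snd c p))"
  proof (rule has_derivative_transform_within_open)
    show "open (snd c ` (fst c \<inter> fst d))" using assms by (intro open_overlap_image open_domain)
    show "snd c p \<in> snd c ` (fst c \<inter> fst d)" using assms by blast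
    show "(local_f d \<circ> (snd d \<circ> chart_inv c)) y = local_f c y"
      if "y \<in> snd c ` (fst c \<inter> fst d)" for y
      using that chart_inv_chart[OF assms(1)] chart_inv_chart[OF assms(2)] by auto
  qed
  moreover have "(local_f c has_derivative local_df c (snd c p)) (at (snd c p))"
    using assms by (intro has_local_df) auto
  ultimately have "local_df d (snd d p) \<circ> transition_derivative c d p = local_df c (snd c p)"
    by (rule has_derivative_unique)
  then show ?thesis by (simp add: fun_eq_iff)
qed

text \<open>
  By the chain rule the description of the differential agrees in all charts, so that one chart is
  enough to compute it.
\<close>

lemma differential_chart:
  assumes "c \<in> A" "p \<in> fst c" "v \<in> tangent_space A p"
  shows "differential A f p v = local_df c (snd c p) (v c)"
  unfolding differential_def
proof (rule the_equality)
  show "\<forall>d\<in>A. p \<in> fst d \<longrightarrow> local_df c (snd c p) (v c) = local_df d (snd d p) (v d)"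
  proof (intro ballI impI)
    fix d assume d: "d \<in> A" "p \<in> fst d"
    have "v d = transition_derivative c d p (v c)"
      using assms d by (intro tangent_component)
    then show "local_df c (snd c p) (v c) = local_df d (snd d p) (v d)"
      using local_df_transition[of c d p "v c"] assms d by simp
  qed
qed (use assms in blast)

lemma chart_metric_components:
  assumes "c \<in> A" "p \<in> fst c" "u \<in> tangent_space A p" "w \<in> tangent_space A p"
  shows "g p u w = chart_metric c (snd c p) (u c) (w c)"
  using assms by (simp add: chart_metric_def chart_inv_chart coord_vector_tangent)

text \<open>
  Tangent vectors correspond to their components in one chart, so this is the Riesz
  representation of the differential by the positive form that the metric induces on components.
\<close>

lemma gradient_exists_unique:
  "\<exists>!u. u \<in> tangent_space A p \<and> (\<forall>w\<in>tangent_space A p. g p u w = differential A f p w)"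
proof -
  obtain c where c: "c \<in> A" "p \<in> fst c" by (rule chart_exists)
  let ?y = "snd c p"
  have y: "?y \<in> chart_image c" using c by blast
  have "\<exists>e. \<forall>w. chart_metric c ?y e w = local_df c ?y w"
    by (rule riesz_positive_form[OF chart_metric_linear_left[OF c(1) y]
          chart_metric_linear_right[OF c(1) y] chart_metric_pos[OF c(1) y] linear_local_df[OF c(1) y]], assumption)
      blast
  then obtain e where e: "\<And>w. chart_metric c ?y e w = local_df c ?y w" by blast
  show ?thesis
  proof (rule ex1I[of _ "coord_vector A c p e"])
    have tangent: "coord_vector A c p e \<in> tangent_space A p"
      using c by (rule coord_vector_in_tangent_space)
    have "g p (coord_vector A c p e) w = differential A f p w" if "w \<in> tangent_space A p" for w
      unfolding chart_metric_components[OF c tangent that] differential_chart[OF c that]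
        coord_vector_self[OF c] by (rule e)
    with tangent show "coord_vector A c p e \<in> tangent_space A p \<and>
        (\<forall>w\<in>tangent_space A p. g p (coord_vector A c p e) w = differential A f p w)" by blast
    fix u
    assume u: "u \<in> tangent_space A p \<and> (\<forall>w\<in>tangent_space A p. g p u w = differential A f p w)"
    have eq: "chart_metric c ?y (u c) w = chart_metric c ?y e w" for w
    proof -
      have w: "coord_vector A c p w \<in> tangent_space A p"
        using c by (rule coord_vector_in_tangent_space)
      have "chart_metric c ?y (u c) w = g p u (coord_vector A c p w)"
        using chart_metric_components[OF c conjunct1[OF u] w] by (simp only: coord_vector_self[OF c])
      also have "\<dots> = local_df c ?y w"
        using bspec[OF conjunct2[OF u] w] differential_chart[OF c w]
        by (simp only: coord_vector_self[OF c])
      finally show ?thesis by (simp only: e)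
    qed
    have "chart_metric c ?y (u c - e) (u c - e) = 0"
      using eq[of "u c - e"] by (simp add: linear_diff[OF chart_metric_linear_left[OF c(1) y]])
    then have "u c - e = 0"
      using chart_metric_pos[OF c(1) y, of "u c - e"] less_irrefl[of 0] by metis
    then show "u = coord_vector A c p e"
      using coord_vector_tangent[OF c conjunct1[OF u]] by simp
  qed
qed

lemma gradient_in_tangent_space: "gradient A g f p \<in> tangent_space A p"
  and metric_gradient: "w \<in> tangent_space A p \<Longrightarrow> g p (gradient A g f p) w = differential A f p w"
proof -
  have "gradient A g f p \<in> tangent_space A p \<and>
      (\<forall>w\<in>tangent_space A p. g p (gradient A g f p) w = differential A f p w)"
    unfolding gradient_def by (rule theI'[OF gradient_exists_unique])
  then show "gradient A g f p \<in> tangent_space A p"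
      "w \<in> tangent_space A p \<Longrightarrow> g p (gradient A g f p) w = differential A f p w"
    by simp_all
qed

lemma chart_metric_gradient:
  assumes "c \<in> A" "p \<in> fst c"
  shows "chart_metric c (snd c p) (gradient A g f p c) w = local_df c (snd c p) w"
proof -
  have w: "coord_vector A c p w \<in> tangent_space A p"
    using assms by (rule coord_vector_in_tangent_space)
  show ?thesis
    using chart_metric_components[OF assms gradient_in_tangent_space w]
      metric_gradient[OF w] differential_chart[OF assms w]
    by (simp add: coord_vector_self assms)
qed

definition neg_gradient :: "'a \<Rightarrow> ('a, 'e) tvec" where
  "neg_gradient p = (\<lambda>c. - gradient A g f p c)"

lemma neg_gradient_in_tangent_space: "neg_gradient p \<in> tangent_space A p"
proof -
  obtain c where c: "c \<in> A" "p \<in> fst c" by (rule chart_exists)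
  have "neg_gradient p = coord_vector A c p (- gradient A g f p c)"
  proof -
    have zero: "coord_vector A c p 0 d = 0" for d
      using fun_cong[OF coord_vector_linear[OF c, of 1 0 0], of d] by simp
    have "coord_vector A c p (- gradient A g f p c) =
        (\<lambda>d. (-1) *\<^sub>R coord_vector A c p (gradient A g f p c) d + coord_vector A c p 0 d)"
      using coord_vector_linear[OF c, of "-1" "gradient A g f p c" 0] by simp
    then show ?thesis
      using coord_vector_tangent[OF c gradient_in_tangent_space] zero by (simp add: neg_gradient_def)
  qed
  then show ?thesis using coord_vector_in_tangent_space[OF c] by simp
qed

definition local_neg_gradient :: "('a, 'e) chart \<Rightarrow> 'e \<Rightarrow> 'e" where
  "local_neg_gradient c y = neg_gradient (chart_inv c y) c"

lemma local_neg_gradient_lipschitz: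
  assumes "c \<in> A" and ball: "cball y r \<subseteq> chart_image c"
  obtains L where "L-lipschitz_on (cball y r) (local_neg_gradient c)"
proof -
  have smooth: "\<exists>L. L-lipschitz_on (cball y r) F" if "smooth_on F (chart_image c)" for F :: "'e \<Rightarrow> real"
  proof -
    have "Ck_on (Suc 0) F (chart_image c)" using that unfolding smooth_on_def by blast
    then show ?thesis using ball by (rule C1_imp_lipschitz_on_cball) blast
  qed
  have "\<exists>L. L-lipschitz_on (cball y r) (\<lambda>z. gradient A g f (chart_inv c z) c)"
  proof (rule represented_field_lipschitz)
    show "compact (cball y r)" by simp
    show "linear (\<lambda>u. chart_metric c z u w)" "linear (chart_metric c z u)"
      if "z \<in> cball y r" for z u w
      by (rule chart_metric_linear[OF \<open>c \<in> A\<close> subsetD[OF ball that]])+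
    show "\<exists>L. L-lipschitz_on (cball y r) (\<lambda>z. chart_metric c z u w)" for u w
      by (rule smooth[OF chart_metric_smooth[OF \<open>c \<in> A\<close>]])
    show "chart_metric c z u u > 0" if "z \<in> cball y r" "u \<noteq> 0" for z u
      by (rule chart_metric_pos[OF \<open>c \<in> A\<close> subsetD[OF ball that(1)] that(2)])
    show "linear (local_df c z)" if "z \<in> cball y r" for z
      by (rule linear_local_df[OF \<open>c \<in> A\<close> subsetD[OF ball that]])
    show "\<exists>L. L-lipschitz_on (cball y r) (\<lambda>z. local_df c z w)" for w
    proof (rule smooth)
      have "Ck_on (Suc k) (local_f c) (chart_image c)" for k
        using smooth_local_f[OF \<open>c \<in> A\<close>] unfolding smooth_on_def by blast
      then show "smooth_on (\<lambda>z. local_df c z w) (chart_image c)"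
        unfolding smooth_on_def by simp
    qed
    show "chart_metric c z (gradient A g f (chart_inv c z) c) w = local_df c z w"
      if "z \<in> cball y r" for z w
      using chart_metric_gradient[OF \<open>c \<in> A\<close>, of "chart_inv c z" w]
        chart_inv_image[OF \<open>c \<in> A\<close> subsetD[OF ball that]] by simp
  qed (intro exI)
  then obtain L where "L-lipschitz_on (cball y r) (\<lambda>z. gradient A g f (chart_inv c z) c)" by blast
  then have "L-lipschitz_on (cball y r) (local_neg_gradient c)"
    unfolding local_neg_gradient_def neg_gradient_def by (rule lipschitz_on_minus)
  then show ?thesis by (rule that)
qed

lemma critical_iff_metric_gradient:
  "critical_point A f p \<longleftrightarrow> g p (gradient A g f p) (gradient A g f p) = 0"
proof
  assume "critical_point A f p"
  then show "g p (gradient A g f p) (gradient A g f p) = 0"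
    using metric_gradient[OF gradient_in_tangent_space] gradient_in_tangent_space
    by (simp add: critical_point_def)
next
  assume "g p (gradient A g f p) (gradient A g f p) = 0"
  then have zero: "gradient A g f p = (\<lambda>c. 0)"
    using metric_pos[OF gradient_in_tangent_space, of p] less_irrefl[of 0] by metis
  obtain c where c: "c \<in> A" "p \<in> fst c" by (rule chart_exists)
  have "local_df c (snd c p) w = 0" for w
    using chart_metric_gradient[OF c, of w] zero
      linear_0[OF chart_metric_linear_left[OF c(1), of "snd c p" w]] c by auto
  then show "critical_point A f p"
    using differential_chart[OF c] by (simp add: critical_point_def)
qed

lemma metric_gradient_nonneg: "g p (gradient A g f p) (gradient A g f p) \<ge> 0"
proof (cases "gradient A g f p = (\<lambda>c. 0)")
  case True
  obtain c where c: "c \<in> A" "p \<in> fst c" by (rule chart_exists)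
  have "chart_metric c (snd c p) 0 0 = 0"
    by (rule linear_0[OF chart_metric_linear_left]) (use c in auto)
  then show ?thesis
    using chart_metric_components[OF c gradient_in_tangent_space gradient_in_tangent_space] True
    by simp
qed (use metric_pos[OF gradient_in_tangent_space] in \<open>simp add: less_imp_le\<close>)

lemma critical_imp_gradient_zero: "critical_point A f p \<Longrightarrow> gradient A g f p = (\<lambda>c. 0)"
  using critical_iff_metric_gradient[of p] metric_pos[OF gradient_in_tangent_space, of p]
    less_irrefl[of 0] by metis

lemma critical_imp_local_df: "critical_point A f p \<Longrightarrow> c \<in> A \<Longrightarrow> p \<in> fst c \<Longrightarrow> local_df c (snd c p) w = 0"
  using differential_chart[OF _ _ coord_vector_in_tangent_space, of c p c w]
    coord_vector_in_tangent_space[of c p w]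
  by (simp add: critical_point_def coord_vector_self)

end

section \<open>Integral curves\<close>

context riemannian_function
begin

definition integral_curve_on :: "(real \<Rightarrow> 'a) \<Rightarrow> real set \<Rightarrow> bool" where
  "integral_curve_on \<gamma> I \<longleftrightarrow> (\<forall>t\<in>I. has_velocity A \<gamma> (neg_gradient (\<gamma> t)) t)"

lemma integral_curve_on_subset: "integral_curve_on \<gamma> I \<Longrightarrow> J \<subseteq> I \<Longrightarrow> integral_curve_on \<gamma> J"
  unfolding integral_curve_on_def by blast

lemma integral_curve_isCont: "integral_curve_on \<gamma> I \<Longrightarrow> t \<in> I \<Longrightarrow> isCont \<gamma> t"
  unfolding integral_curve_on_def has_velocity_def by blast

lemma integral_curve_chart:
  assumes "integral_curve_on \<gamma> I" "t \<in> I" "c \<in> A" "\<gamma> t \<in> fst c"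
  shows "((snd c \<circ> \<gamma>) has_vector_derivative local_neg_gradient c (snd c (\<gamma> t))) (at t)"
proof -
  have "((snd c \<circ> \<gamma>) has_vector_derivative neg_gradient (\<gamma> t) c) (at t)"
    using assms unfolding integral_curve_on_def has_velocity_def by blast
  then show ?thesis by (simp add: local_neg_gradient_def chart_inv_chart[OF assms(3,4)])
qed

lemma isCont_eventually_in_open:
  assumes "isCont \<gamma> t" "open U" "\<gamma> t \<in> U"
  shows "\<forall>\<^sub>F s in nhds t. \<gamma> s \<in> U"
proof -
  have "\<forall>\<^sub>F s in at t. \<gamma> s \<in> U"
    using assms by (intro topological_tendstoD[of \<gamma> "\<gamma> t"]) (simp_all add: isCont_def)
  then show ?thesis using assms(3) by (simp add: eventually_nhds_conv_at)
qed

text \<open>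
  Both the components of a tangent vector and the velocity of a curve change by the derivative
  of the coordinate change, so a velocity can be verified in a single chart.
\<close>

lemma has_velocity_if_chart:
  assumes "c \<in> A" "\<gamma> t \<in> fst c" "isCont \<gamma> t" "v \<in> tangent_space A (\<gamma> t)"
    and der: "((snd c \<circ> \<gamma>) has_vector_derivative v c) (at t)"
  shows "has_velocity A \<gamma> v t"
  unfolding has_velocity_def
proof (intro conjI ballI impI)
  fix d assume d: "d \<in> A" "\<gamma> t \<in> fst d"
  have "((snd d \<circ> chart_inv c) has_derivative transition_derivative c d (\<gamma> t))
      (at ((snd c \<circ> \<gamma>) t))"
    using has_transition_derivative[OF assms(1) d(1) assms(2) d(2)] by simp
  then have "((snd d \<circ> chart_inv c) \<circ> (snd c \<circ> \<gamma>) has_derivative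
      transition_derivative c d (\<gamma> t) \<circ> (\<lambda>h. h *\<^sub>R v c)) (at t)"
    by (rule diff_chain_at[OF der[unfolded has_vector_derivative_def]])
  moreover have "transition_derivative c d (\<gamma> t) \<circ> (\<lambda>h. h *\<^sub>R v c) = (\<lambda>h. h *\<^sub>R v d)"
    using linear_cmul[OF linear_transition_derivative[OF assms(1) d(1) assms(2) d(2)]]
      tangent_component[OF assms(4,1) d(1) assms(2) d(2)] by (simp add: fun_eq_iff)
  ultimately have "((snd d \<circ> chart_inv c) \<circ> (snd c \<circ> \<gamma>) has_derivative (\<lambda>h. h *\<^sub>R v d)) (at t)"
    by simp
  moreover have "\<forall>\<^sub>F s in at t. ((snd d \<circ> chart_inv c) \<circ> (snd c \<circ> \<gamma>)) s = (snd d \<circ> \<gamma>) s"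
  proof -
    have "\<forall>\<^sub>F s in at t. \<gamma> s \<in> fst c"
      using isCont_eventually_in_open[OF assms(3) open_domain[OF assms(1)] assms(2)]
      by (simp add: eventually_nhds_conv_at)
    then show ?thesis
      by (rule eventually_mono) (simp add: chart_inv_chart[OF assms(1)])
  qed
  ultimately show "((snd d \<circ> \<gamma>) has_vector_derivative v d) (at t)"
    unfolding has_vector_derivative_def
    by (rule has_derivative_transform_eventually) (simp_all add: chart_inv_chart[OF assms(1,2)])
qed (use assms in auto)

lemma has_velocity_transform:
  assumes "has_velocity A \<gamma> v t" and eq: "\<forall>\<^sub>F s in nhds t. \<gamma> s = \<delta> s"
  shows "has_velocity A \<delta> v t"
proof -
  have t: "\<gamma> t = \<delta> t" using eq by (rule eventually_nhds_x_imp_x)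
  have at: "\<forall>\<^sub>F s in at t. \<gamma> s = \<delta> s" using eq by (simp add: eventually_nhds_conv_at)
  show ?thesis
    unfolding has_velocity_def
  proof (intro conjI ballI impI)
    show "v \<in> tangent_space A (\<delta> t)" using assms(1) t by (simp add: has_velocity_def)
    have "isCont \<gamma> t" using assms(1) by (simp add: has_velocity_def)
    then show "isCont \<delta> t" using isCont_cong[OF eq] by simp
    fix c assume c: "c \<in> A" "\<delta> t \<in> fst c"
    then have "((snd c \<circ> \<gamma>) has_derivative (\<lambda>h. h *\<^sub>R v c)) (at t)"
      using assms(1) t unfolding has_velocity_def has_vector_derivative_def by metis
    then show "((snd c \<circ> \<delta>) has_vector_derivative v c) (at t)"
      unfolding has_vector_derivative_def
      by (rule has_derivative_transform_eventually)
        (use at t in \<open>auto elim: eventually_mono\<close>)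
  qed
qed

lemma integral_curve_transform:
  assumes "integral_curve_on \<gamma> I" and "open I" and eq: "\<And>t. t \<in> I \<Longrightarrow> \<gamma> t = \<delta> t"
  shows "integral_curve_on \<delta> I"
  unfolding integral_curve_on_def
proof
  fix t assume t: "t \<in> I"
  have "has_velocity A \<gamma> (neg_gradient (\<gamma> t)) t"
    using assms(1) t unfolding integral_curve_on_def by (rule bspec)
  then have "has_velocity A \<gamma> (neg_gradient (\<delta> t)) t" by (simp only: eq[OF t])
  moreover have "\<forall>\<^sub>F s in nhds t. \<gamma> s = \<delta> s"
    using eventually_nhds_in_open[OF \<open>open I\<close> t] by (rule eventually_mono) (rule eq)
  ultimately show "has_velocity A \<delta> (neg_gradient (\<delta> t)) t" by (rule has_velocity_transform)
qed

lemma integral_curve_shift: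
  assumes "integral_curve_on \<gamma> I" and "\<And>t. t \<in> J \<Longrightarrow> t + s \<in> I"
  shows "integral_curve_on (\<lambda>t. \<gamma> (t + s)) J"
  unfolding integral_curve_on_def has_velocity_def
proof (intro ballI conjI impI)
  fix t assume t: "t \<in> J"
  show "neg_gradient (\<gamma> (t + s)) \<in> tangent_space A (\<gamma> (t + s))" by (rule neg_gradient_in_tangent_space)
  have "isCont \<gamma> (t + s)" using assms(1) assms(2)[OF t] by (rule integral_curve_isCont)
  moreover have "isCont (\<lambda>t. t + s) t" by (intro continuous_intros)
  ultimately show "isCont (\<lambda>t. \<gamma> (t + s)) t" by (rule isCont_o2[rotated])
  fix c assume c: "c \<in> A" "\<gamma> (t + s) \<in> fst c"
  have "((\<lambda>t. t + s) has_vector_derivative 1) (at t)"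
    by (auto intro!: derivative_eq_intros)
  moreover have "((snd c \<circ> \<gamma>) has_vector_derivative neg_gradient (\<gamma> (t + s)) c) (at (t + s))"
    using bspec[OF assms(1)[unfolded integral_curve_on_def] assms(2)[OF t]] c
    unfolding has_velocity_def by blast
  ultimately have "((snd c \<circ> \<gamma>) \<circ> (\<lambda>t. t + s) has_vector_derivative 1 *\<^sub>R neg_gradient (\<gamma> (t + s)) c) (at t)"
    by (rule vector_diff_chain_at)
  then show "((snd c \<circ> (\<lambda>t. \<gamma> (t + s))) has_vector_derivative neg_gradient (\<gamma> (t + s)) c) (at t)"
    by (simp add: o_def)
qed

lemma cball_in_chart:
  assumes "c \<in> A" "x \<in> fst c"
  obtains r where "r > 0" "cball (snd c x) r \<subseteq> chart_image c"
proof -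
  have "snd c x \<in> chart_image c" using assms(2) by blast
  then show ?thesis using open_contains_cball[of "chart_image c"] open_image[OF assms(1)] that by blast
qed

lemma integral_curves_locally_equal:
  assumes \<gamma>: "integral_curve_on \<gamma> I" and \<delta>: "integral_curve_on \<delta> I" and "open I" "t \<in> I"
    and eq: "\<gamma> t = \<delta> t"
  shows "\<forall>\<^sub>F s in nhds t. \<gamma> s = \<delta> s"
proof -
  obtain c where c: "c \<in> A" "\<gamma> t \<in> fst c" by (rule chart_exists)
  obtain r where r: "r > 0" "cball (snd c (\<gamma> t)) r \<subseteq> chart_image c" using c by (rule cball_in_chart)
  obtain L where L: "L-lipschitz_on (cball (snd c (\<gamma> t)) r) (local_neg_gradient c)"
    using c(1) r(2) by (rule local_neg_gradient_lipschitz)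
  define W where "W = fst c \<inter> snd c -` ball (snd c (\<gamma> t)) r"
  have W: "open W" "\<gamma> t \<in> W"
    unfolding W_def using open_chart_preimage[OF c(1)] c r(1) by auto
  have "\<forall>\<^sub>F s in nhds t. \<gamma> s \<in> W" "\<forall>\<^sub>F s in nhds t. \<delta> s \<in> W"
    using W eq integral_curve_isCont[OF \<gamma> \<open>t \<in> I\<close>] integral_curve_isCont[OF \<delta> \<open>t \<in> I\<close>]
    by (auto intro: isCont_eventually_in_open)
  then have "\<forall>\<^sub>F s in nhds t. s \<in> I \<and> \<gamma> s \<in> W \<and> \<delta> s \<in> W"
    using eventually_nhds_in_open[OF \<open>open I\<close> \<open>t \<in> I\<close>] by (intro eventually_conj)
  then obtain e where e: "e > 0" "\<And>s. dist s t < e \<Longrightarrow> s \<in> I \<and> \<gamma> s \<in> W \<and> \<delta> s \<in> W"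
    unfolding eventually_nhds_metric by blast
  have near: "s \<in> I" "\<gamma> s \<in> W" "\<delta> s \<in> W" if "s \<in> {t - e<..<t + e}" for s
    using e(2)[of s] that by (auto simp: dist_real_def)
  have "\<gamma> s = \<delta> s" if s: "s \<in> {t - e<..<t + e}" for s
  proof -
    have curve: "(snd c \<circ> \<epsilon>) s \<in> cball (snd c (\<gamma> t)) r \<and>
        ((snd c \<circ> \<epsilon>) has_vector_derivative local_neg_gradient c ((snd c \<circ> \<epsilon>) s)) (at s)"
      if "integral_curve_on \<epsilon> I" "s \<in> I" "\<epsilon> s \<in> W" for \<epsilon> s
      using integral_curve_chart[OF that(1,2) c(1)] that(3) by (auto simp: W_def)
    have "norm ((snd c \<circ> \<gamma>) s - (snd c \<circ> \<delta>) s)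
        \<le> exp (L * \<bar>s - t\<bar>) * norm ((snd c \<circ> \<gamma>) t - (snd c \<circ> \<delta>) t)"
    proof (rule lipschitz_curves_norm_le[OF L])
      show "t \<in> {t - e<..<t + e}" using e(1) by simp
    qed (rule curve[OF \<gamma> near(1,2)] curve[OF \<delta> near(1,3)] s; assumption?)+
    then have "snd c (\<gamma> s) = snd c (\<delta> s)" using eq by simp
    moreover have "\<gamma> s \<in> fst c" "\<delta> s \<in> fst c" using near[OF s] by (simp_all add: W_def)
    ultimately show ?thesis using chart_inv_chart[OF c(1)] by metis
  qed
  then have "\<forall>s. dist s t < e \<longrightarrow> \<gamma> s = \<delta> s"
    by (simp add: dist_real_def abs_less_iff algebra_simps)
  with e(1) show ?thesis unfolding eventually_nhds_metric by blast
qed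

text \<open>
  The set of times at which the two curves agree is open by local uniqueness in a chart and
  relatively closed by continuity.
\<close>

lemma integral_curve_unique:
  assumes \<gamma>: "integral_curve_on \<gamma> I" and \<delta>: "integral_curve_on \<delta> I"
    and "open I" "connected I" "s \<in> I" "\<gamma> s = \<delta> s" "t \<in> I"
  shows "\<gamma> t = \<delta> t"
proof -
  let ?E = "{t\<in>I. \<gamma> t = \<delta> t}" and ?N = "{t\<in>I. \<gamma> t \<noteq> \<delta> t}"
  have "open ?E"
    unfolding open_subopen[of ?E]
  proof
    fix t assume "t \<in> ?E"
    then have "\<forall>\<^sub>F s in nhds t. s \<in> I" "\<forall>\<^sub>F s in nhds t. \<gamma> s = \<delta> s"
      using eventually_nhds_in_open[OF \<open>open I\<close>] integral_curves_locally_equal[OF \<gamma> \<delta> \<open>open I\<close>]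
      by simp_all
    then have "\<forall>\<^sub>F s in nhds t. s \<in> ?E" by eventually_elim simp
    then show "\<exists>T. open T \<and> t \<in> T \<and> T \<subseteq> ?E" unfolding eventually_nhds by blast
  qed
  moreover have "open ?N"
    unfolding open_subopen[of ?N]
  proof
    fix t assume t: "t \<in> ?N"
    then obtain U V where UV: "open U" "open V" "\<gamma> t \<in> U" "\<delta> t \<in> V" "U \<inter> V = {}"
      using separation_t2[of "\<gamma> t" "\<delta> t"] by auto
    have "\<forall>\<^sub>F s in nhds t. s \<in> I" "\<forall>\<^sub>F s in nhds t. \<gamma> s \<in> U" "\<forall>\<^sub>F s in nhds t. \<delta> s \<in> V"
      using eventually_nhds_in_open[OF \<open>open I\<close>] t UV
        isCont_eventually_in_open[OF integral_curve_isCont[OF \<gamma>]]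
        isCont_eventually_in_open[OF integral_curve_isCont[OF \<delta>]] by simp_all
    then have "\<forall>\<^sub>F s in nhds t. s \<in> ?N" by eventually_elim (use UV(5) in auto)
    then show "\<exists>T. open T \<and> t \<in> T \<and> T \<subseteq> ?N" unfolding eventually_nhds by blast
  qed
  ultimately have "?E \<inter> I = {} \<or> ?N \<inter> I = {}"
    by (intro connectedD[OF \<open>connected I\<close>]) auto
  with assms(5-7) show ?thesis by blast
qed

text \<open>
  The solutions of the chart equation exist for a common time and depend in a Lipschitz way on the
  initial value. Transported to the manifold, they form a local flow that is jointly continuous.
\<close>

lemma flow_box:
  obtains U h \<Psi> where "open U" "x \<in> U" "h > 0" "\<And>y. y \<in> U \<Longrightarrow> \<Psi> y 0 = y"
    "\<And>y. y \<in> U \<Longrightarrow> integral_curve_on (\<Psi> y) {-h<..<h}"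
    "continuous_on (U \<times> {-h<..<h}) (\<lambda>p. \<Psi> (fst p) (snd p))"
proof -
  obtain c where c: "c \<in> A" "x \<in> fst c" by (rule chart_exists)
  obtain r0 where r0: "r0 > 0" "cball (snd c x) r0 \<subseteq> chart_image c" using c by (rule cball_in_chart)
  define r where "r = r0 / 2"
  have r: "r > 0" and ball: "cball (snd c x) (2 * r) \<subseteq> chart_image c" using r0 by (auto simp: r_def)
  obtain L where L: "L-lipschitz_on (cball (snd c x) (2 * r)) (local_neg_gradient c)"
    using c(1) ball by (rule local_neg_gradient_lipschitz)
  obtain h where h: "h > 0" and ex: "\<And>y. y \<in> cball (snd c x) r \<Longrightarrow> \<exists>\<eta>. \<eta> 0 = y \<and>
      (\<forall>t\<in>{-h<..<h}. \<eta> t \<in> cball (snd c x) (2 * r) \<and>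
        (\<eta> has_vector_derivative local_neg_gradient c (\<eta> t)) (at t))"
    using picard_local_solutions[OF r L] by blast
  have "\<exists>\<eta>. \<forall>y\<in>cball (snd c x) r. \<eta> y 0 = y \<and> (\<forall>t\<in>{-h<..<h}.
      \<eta> y t \<in> cball (snd c x) (2 * r) \<and>
      (\<eta> y has_vector_derivative local_neg_gradient c (\<eta> y t)) (at t))"
    using ex by (intro bchoice ballI)
  then obtain \<eta> where all: "\<forall>y\<in>cball (snd c x) r. \<eta> y 0 = y \<and> (\<forall>t\<in>{-h<..<h}.
      \<eta> y t \<in> cball (snd c x) (2 * r) \<and>
      (\<eta> y has_vector_derivative local_neg_gradient c (\<eta> y t)) (at t))"
    by (rule exE)
  have \<eta>0: "\<eta> y 0 = y" if "y \<in> cball (snd c x) r" for y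
    using all that by blast
  have \<eta>: "\<eta> y t \<in> cball (snd c x) (2 * r)"
      and d\<eta>: "(\<eta> y has_vector_derivative local_neg_gradient c (\<eta> y t)) (at t)"
    if "y \<in> cball (snd c x) r" "t \<in> {-h<..<h}" for y t
    using all that by blast+
  define U where "U = fst c \<inter> snd c -` ball (snd c x) r"
  have U: "open U" "x \<in> U"
    unfolding U_def using c r by (simp_all add: open_chart_preimage)
  have U_ball: "snd c y \<in> cball (snd c x) r" and U_dom: "y \<in> fst c" if "y \<in> U" for y
    using that by (auto simp: U_def)
  define \<Psi> where "\<Psi> y t = chart_inv c (\<eta> (snd c y) t)" for y t
  have in_image: "\<eta> (snd c y) t \<in> chart_image c" if "y \<in> U" "t \<in> {-h<..<h}" for y t
    using \<eta>[OF U_ball[OF that(1)] that(2)] ball by blast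
  have \<eta>_cont: "isCont (\<eta> (snd c y)) t" if "y \<in> U" "t \<in> {-h<..<h}" for y t
    by (rule has_vector_derivative_continuous[OF d\<eta>[OF U_ball[OF that(1)] that(2)]])
  have curve: "integral_curve_on (\<Psi> y) {-h<..<h}" if y: "y \<in> U" for y
    unfolding integral_curve_on_def
  proof
    fix t assume t: "t \<in> {-h<..<h}"
    show "has_velocity A (\<Psi> y) (neg_gradient (\<Psi> y t)) t"
    proof (rule has_velocity_if_chart[OF c(1)])
      show dom: "\<Psi> y t \<in> fst c"
        unfolding \<Psi>_def by (rule chart_inv_image(1)[OF c(1) in_image[OF y t]])
      show "isCont (\<Psi> y) t"
        unfolding \<Psi>_def
        by (rule isCont_o2[OF \<eta>_cont[OF y t] isCont_chart_inv[OF c(1) in_image[OF y t]]])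
      show "neg_gradient (\<Psi> y t) \<in> tangent_space A (\<Psi> y t)" by (rule neg_gradient_in_tangent_space)
      have "(\<eta> (snd c y) has_vector_derivative local_neg_gradient c (\<eta> (snd c y) t)) (at t)"
        by (rule d\<eta>[OF U_ball[OF y] t])
      then have "(\<eta> (snd c y) has_vector_derivative neg_gradient (\<Psi> y t) c) (at t)"
        by (simp add: local_neg_gradient_def \<Psi>_def)
      then show "((snd c \<circ> \<Psi> y) has_vector_derivative neg_gradient (\<Psi> y t) c) (at t)"
      proof (rule has_vector_derivative_transform_within_open)
        show "\<eta> (snd c y) s = (snd c \<circ> \<Psi> y) s" if "s \<in> {-h<..<h}" for s
          using chart_inv_image(2)[OF c(1) in_image[OF y that]] by (simp add: \<Psi>_def)
      qed (use t in auto)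
    qed
  qed
  have "continuous_on (U \<times> {-h<..<h}) (\<lambda>p. \<eta> (snd c (fst p)) (snd p))"
    unfolding continuous_on
  proof
    fix q assume "q \<in> U \<times> {-h<..<h}"
    then obtain y t where q: "q = (y, t)" "y \<in> U" "t \<in> {-h<..<h}" by auto
    let ?F = "at q within U \<times> {-h<..<h}"
    let ?b = "\<lambda>p. exp (L * h) * norm (snd c (fst p) - snd c y)
        + norm (\<eta> (snd c y) (snd p) - \<eta> (snd c y) t)"
    have fst_q: "(fst \<longlongrightarrow> y) ?F" and snd_q: "(snd \<longlongrightarrow> t) ?F"
      using tendsto_fst[OF tendsto_ident_at, of q] tendsto_snd[OF tendsto_ident_at, of q] q(1)
      by simp_all
    have "((\<lambda>p. \<eta> (snd c (fst p)) (snd p) - \<eta> (snd c y) t) \<longlongrightarrow> 0) ?F"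
    proof (rule Lim_null_comparison)
      have "((\<lambda>p. snd c (fst p)) \<longlongrightarrow> snd c y) ?F"
        using isCont_tendsto_compose[OF isCont_chart[OF c(1) U_dom[OF q(2)]] fst_q] .
      moreover have "((\<lambda>p. \<eta> (snd c y) (snd p)) \<longlongrightarrow> \<eta> (snd c y) t) ?F"
        using isCont_tendsto_compose[OF \<eta>_cont[OF q(2,3)] snd_q] .
      ultimately have "(?b \<longlongrightarrow> exp (L * h) * norm (snd c y - snd c y)
          + norm (\<eta> (snd c y) t - \<eta> (snd c y) t)) ?F"
        by (intro tendsto_intros)
      then show "(?b \<longlongrightarrow> 0) ?F" by simp
      have "norm (\<eta> (snd c (fst p)) (snd p) - \<eta> (snd c y) t) \<le> ?b p"
        if p: "p \<in> U \<times> {-h<..<h}" for p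
      proof -
        have p': "fst p \<in> U" "snd p \<in> {-h<..<h}" using p by auto
        have "norm (\<eta> (snd c (fst p)) (snd p) - \<eta> (snd c y) (snd p))
            \<le> exp (L * \<bar>snd p - 0\<bar>) * norm (\<eta> (snd c (fst p)) 0 - \<eta> (snd c y) 0)"
          by (rule lipschitz_curves_norm_le[OF L _ _ _ p'(2)])
            (use h in \<open>simp_all add: \<eta> d\<eta> U_ball p'(1) q(2) del: mem_cball\<close>)
        also have "\<dots> = exp (L * \<bar>snd p\<bar>) * norm (snd c (fst p) - snd c y)"
          by (simp add: \<eta>0[OF U_ball[OF p'(1)]] \<eta>0[OF U_ball[OF q(2)]])
        also have "\<dots> \<le> exp (L * h) * norm (snd c (fst p) - snd c y)"
          using p'(2) lipschitz_on_nonneg[OF L] by (intro mult_right_mono) (auto intro!: mult_left_mono)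
        finally have "norm (\<eta> (snd c (fst p)) (snd p) - \<eta> (snd c y) (snd p))
            \<le> exp (L * h) * norm (snd c (fst p) - snd c y)" .
        then show ?thesis
          using norm_triangle_ineq[of "\<eta> (snd c (fst p)) (snd p) - \<eta> (snd c y) (snd p)"
              "\<eta> (snd c y) (snd p) - \<eta> (snd c y) t"] by simp
      qed
      then show "\<forall>\<^sub>F p in ?F. norm (\<eta> (snd c (fst p)) (snd p) - \<eta> (snd c y) t) \<le> ?b p"
        by (simp add: eventually_at_filter)
    qed
    then show "((\<lambda>p. \<eta> (snd c (fst p)) (snd p)) \<longlongrightarrow> \<eta> (snd c (fst q)) (snd q)) ?F"
      using q(1) by (simp add: Lim_null[symmetric])
  qed
  then have "continuous_on (U \<times> {-h<..<h}) (\<lambda>p. \<Psi> (fst p) (snd p))"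
    unfolding \<Psi>_def
    by (rule continuous_on_compose2[OF continuous_chart_inv[OF c(1)]]) (use in_image in auto)
  moreover have "\<Psi> y 0 = y" if "y \<in> U" for y
    unfolding \<Psi>_def using \<eta>0[OF U_ball[OF that]] chart_inv_chart[OF c(1) U_dom[OF that]] by simp
  ultimately show ?thesis using that[of U h \<Psi>] U h curve by blast
qed

lemma integral_curves_glue:
  assumes \<gamma>: "integral_curve_on \<gamma> {a<..<b}" and \<delta>: "integral_curve_on \<delta> {a'<..<b'}"
    and s: "s \<in> {a<..<b}" "s \<in> {a'<..<b'}" "\<gamma> s = \<delta> s"
  obtains \<epsilon> where "integral_curve_on \<epsilon> ({a<..<b} \<union> {a'<..<b'})" "\<And>t. t \<in> {a<..<b} \<Longrightarrow> \<epsilon> t = \<gamma> t"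
proof -
  have agree: "\<gamma> t = \<delta> t" if "t \<in> {a<..<b}" "t \<in> {a'<..<b'}" for t
  proof (rule integral_curve_unique[where s = s and I = "{max a a'<..<min b b'}"])
    show "integral_curve_on \<gamma> {max a a'<..<min b b'}" using \<gamma> by (rule integral_curve_on_subset) auto
    show "integral_curve_on \<delta> {max a a'<..<min b b'}" using \<delta> by (rule integral_curve_on_subset) auto
  qed (use s that in auto)
  define \<epsilon> where "\<epsilon> t = (if t \<in> {a<..<b} then \<gamma> t else \<delta> t)" for t
  have "integral_curve_on \<epsilon> {a<..<b}"
    by (rule integral_curve_transform[OF \<gamma>]) (auto simp: \<epsilon>_def)
  moreover have "integral_curve_on \<epsilon> {a'<..<b'}"
    by (rule integral_curve_transform[OF \<delta>]) (use agree in \<open>auto simp: \<epsilon>_def\<close>)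
  ultimately have "integral_curve_on \<epsilon> ({a<..<b} \<union> {a'<..<b'})"
    unfolding integral_curve_on_def by blast
  then show ?thesis by (rule that) (auto simp: \<epsilon>_def)
qed

end

section \<open>The negative gradient flow on a compact manifold\<close>

locale compact_riemannian_function = riemannian_function +
  assumes compact_space: "compact (UNIV :: 'a set)"
begin

lemma uniform_existence_time:
  obtains h where "h > 0" "\<And>y. \<exists>\<gamma>. \<gamma> 0 = y \<and> integral_curve_on \<gamma> {-h<..<h}"
proof -
  have "\<forall>x. \<exists>U h. open U \<and> x \<in> U \<and> h > 0 \<and>
      (\<forall>y\<in>U. \<exists>\<gamma>. \<gamma> 0 = y \<and> integral_curve_on \<gamma> {-h<..<h})"
  proof
    fix x
    show "\<exists>U h. open U \<and> x \<in> U \<and> h > 0 \<and>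
        (\<forall>y\<in>U. \<exists>\<gamma>. \<gamma> 0 = y \<and> integral_curve_on \<gamma> {-h<..<h})"
      by (rule flow_box[of x]) blast
  qed
  then obtain U h where Uh: "\<And>x. open (U x)" "\<And>x. x \<in> U x" "\<And>x. h x > (0::real)"
      "\<And>x y. y \<in> U x \<Longrightarrow> \<exists>\<gamma>. \<gamma> 0 = y \<and> integral_curve_on \<gamma> {-h x<..<h x}"
    by metis
  obtain D where D: "finite D" "UNIV \<subseteq> (\<Union>x\<in>D. U x)"
    by (rule compactE_image[OF compact_space, of UNIV U]) (use Uh(1,2) in auto)
  have "D \<noteq> {}" using D(2) by auto
  show ?thesis
  proof (rule that[of "Min (h ` D)"])
    show "Min (h ` D) > 0" using D(1) \<open>D \<noteq> {}\<close> Uh(3) by simp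
    fix y
    obtain x where x: "x \<in> D" "y \<in> U x" using D(2) by blast
    obtain \<gamma> where \<gamma>: "\<gamma> 0 = y" "integral_curve_on \<gamma> {-h x<..<h x}" using Uh(4)[OF x(2)] by blast
    have "Min (h ` D) \<le> h x" using D(1) x(1) by simp
    then have "integral_curve_on \<gamma> {-Min (h ` D)<..<Min (h ` D)}"
      by (intro integral_curve_on_subset[OF \<gamma>(2)]) auto
    with \<gamma>(1) show "\<exists>\<gamma>. \<gamma> 0 = y \<and> integral_curve_on \<gamma> {-Min (h ` D)<..<Min (h ` D)}" by blast
  qed
qed

lemma integral_curve_extend:
  assumes h: "\<And>y. \<exists>\<gamma>. \<gamma> 0 = y \<and> integral_curve_on \<gamma> {-h<..<h}"
    and \<gamma>: "integral_curve_on \<gamma> {a<..<b}" and s: "s \<in> {a<..<b}" and "h > 0"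
  obtains \<epsilon> where "integral_curve_on \<epsilon> ({a<..<b} \<union> {s - h<..<s + h})"
    "\<And>t. t \<in> {a<..<b} \<Longrightarrow> \<epsilon> t = \<gamma> t"
proof -
  obtain \<delta> where \<delta>: "\<delta> 0 = \<gamma> s" "integral_curve_on \<delta> {-h<..<h}" using h by blast
  have "integral_curve_on (\<lambda>t. \<delta> (t + (- s))) {s - h<..<s + h}"
    by (rule integral_curve_shift[OF \<delta>(2)]) auto
  then show ?thesis
    by (rule integral_curves_glue[OF \<gamma> _ s]) (use \<open>h > 0\<close> \<delta>(1) that in auto)
qed

text \<open>
  The symmetric interval of definition grows by \<open>k\<close>, half of the uniform time of existence, at each
  step: a short integral curve that starts at distance \<open>k\<close> before either end is glued on. By uniqueness
  the curves on these intervals agree with each other and define a curve on the whole line.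
\<close>

lemma integral_curve_global:
  obtains \<gamma> where "\<gamma> 0 = x" "integral_curve_on \<gamma> UNIV"
proof -
  obtain h where h: "h > 0" "\<And>y. \<exists>\<gamma>. \<gamma> 0 = y \<and> integral_curve_on \<gamma> {-h<..<h}"
    by (rule uniform_existence_time) blast
  define k where "k = h / 2"
  have k: "k > 0" "h = 2 * k" using h(1) by (simp_all add: k_def)
  define R where "R n = (real n + 1) * k" for n :: nat
  have R_Suc: "R (Suc n) = R n + k" and R_ge: "k \<le> R n" for n
    using k(1) by (simp_all add: R_def algebra_simps)
  have "\<exists>\<gamma>. \<gamma> 0 = x \<and> integral_curve_on \<gamma> {-R n<..<R n}" for n
  proof (induction n)
    case 0
    obtain \<gamma> where "\<gamma> 0 = x" "integral_curve_on \<gamma> {-h<..<h}" using h(2) by blast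
    moreover have "{-R 0<..<R 0} \<subseteq> {-h<..<h}" using k by (auto simp: R_def)
    ultimately show ?case using integral_curve_on_subset by blast
  next
    case (Suc n)
    then obtain \<gamma> where \<gamma>: "\<gamma> 0 = x" "integral_curve_on \<gamma> {-R n<..<R n}" by blast
    obtain \<delta> where \<delta>: "integral_curve_on \<delta> ({-R n<..<R n} \<union> {(R n - k) - h<..<(R n - k) + h})"
        "\<And>t. t \<in> {-R n<..<R n} \<Longrightarrow> \<delta> t = \<gamma> t"
      using integral_curve_extend[OF h(2) \<gamma>(2), of "R n - k"] k R_ge[of n] by auto
    have "integral_curve_on \<delta> {-R n<..<R n + k}"
      using \<delta>(1) by (rule integral_curve_on_subset) (use k R_ge[of n] in auto)
    then obtain \<epsilon> where \<epsilon>: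
        "integral_curve_on \<epsilon> ({-R n<..<R n + k} \<union> {- (R n - k) - h<..<- (R n - k) + h})"
        "\<And>t. t \<in> {-R n<..<R n + k} \<Longrightarrow> \<epsilon> t = \<delta> t"
      using integral_curve_extend[OF h(2), of \<delta> "-R n" "R n + k" "- (R n - k)"] k R_ge[of n] by auto
    have "integral_curve_on \<epsilon> {-R (Suc n)<..<R (Suc n)}"
      using \<epsilon>(1) by (rule integral_curve_on_subset) (use k R_ge[of n] R_Suc[of n] in auto)
    moreover have "\<epsilon> 0 = x" using \<epsilon>(2)[of 0] \<delta>(2)[of 0] \<gamma>(1) k R_ge[of n] by simp
    ultimately show ?case by blast
  qed
  then obtain \<Gamma> where \<Gamma>: "\<And>n. \<Gamma> n 0 = x" "\<And>n. integral_curve_on (\<Gamma> n) {-R n<..<R n}" by metis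
  have agree: "\<Gamma> m t = \<Gamma> n t" if "\<bar>t\<bar> < R m" "\<bar>t\<bar> < R n" for m n t
  proof (rule integral_curve_unique[where s = 0 and I = "{-min (R m) (R n)<..<min (R m) (R n)}"])
    show "integral_curve_on (\<Gamma> m) {-min (R m) (R n)<..<min (R m) (R n)}"
      by (rule integral_curve_on_subset[OF \<Gamma>(2)]) auto
    show "integral_curve_on (\<Gamma> n) {-min (R m) (R n)<..<min (R m) (R n)}"
      by (rule integral_curve_on_subset[OF \<Gamma>(2)]) auto
  qed (use that \<Gamma>(1) in auto)
  define N where "N t = nat \<lceil>\<bar>t\<bar> / k\<rceil>" for t
  have N: "\<bar>t\<bar> < R (N t)" for t
  proof -
    have "\<bar>t\<bar> / k \<le> real (N t)" unfolding N_def by (rule real_nat_ceiling_ge)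
    then have "\<bar>t\<bar> \<le> real (N t) * k" using k(1) by (simp add: pos_divide_le_eq)
    then show ?thesis using k(1) by (simp add: R_def algebra_simps)
  qed
  define \<gamma> where "\<gamma> t = \<Gamma> (N t) t" for t
  have "integral_curve_on \<gamma> UNIV"
    unfolding integral_curve_on_def
  proof
    fix t
    have "integral_curve_on \<gamma> {-R (N t)<..<R (N t)}"
    proof (rule integral_curve_transform[OF \<Gamma>(2)[of "N t"]])
      show "\<Gamma> (N t) s = \<gamma> s" if "s \<in> {-R (N t)<..<R (N t)}" for s
        unfolding \<gamma>_def by (rule agree) (use that N in auto)
    qed simp
    moreover have "t \<in> {-R (N t)<..<R (N t)}" using N[of t] by auto
    ultimately show "has_velocity A \<gamma> (neg_gradient (\<gamma> t)) t"
      unfolding integral_curve_on_def by (rule bspec)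
  qed
  moreover have "\<gamma> 0 = x" by (simp add: \<gamma>_def \<Gamma>(1))
  ultimately show ?thesis by (intro that)
qed

abbreviation \<Phi> :: "'a \<Rightarrow> real \<Rightarrow> 'a" where
  "\<Phi> \<equiv> negative_gradient_flow A g f"

lemma is_flow_iff:
  "is_negative_gradient_flow A g f \<Psi> \<longleftrightarrow> (\<forall>x. \<Psi> x 0 = x \<and> integral_curve_on (\<Psi> x) UNIV)"
  by (simp add: is_negative_gradient_flow_def integral_curve_on_def neg_gradient_def)

lemma flow:
  shows flow_zero: "\<Phi> x 0 = x" and flow_integral_curve: "integral_curve_on (\<Phi> x) UNIV"
proof -
  have "\<exists>\<gamma>. \<gamma> 0 = x \<and> integral_curve_on \<gamma> UNIV" for x
    by (rule integral_curve_global[of x]) blast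
  then obtain \<Psi> where \<Psi>: "\<And>x. \<Psi> x 0 = x" "\<And>x. integral_curve_on (\<Psi> x) UNIV" by metis
  have "is_negative_gradient_flow A g f \<Phi>"
    unfolding negative_gradient_flow_def
  proof (rule theI[of "is_negative_gradient_flow A g f" \<Psi>])
    show "is_negative_gradient_flow A g f \<Psi>" by (simp add: is_flow_iff \<Psi>)
    fix \<Psi>' assume \<Psi>': "is_negative_gradient_flow A g f \<Psi>'"
    show "\<Psi>' = \<Psi>"
    proof (intro ext)
      fix x t
      have "\<Psi>' x 0 = \<Psi> x 0" "integral_curve_on (\<Psi>' x) UNIV"
        using \<Psi>' \<Psi>(1) by (simp_all add: is_flow_iff)
      then show "\<Psi>' x t = \<Psi> x t"
        using integral_curve_unique[OF _ \<Psi>(2) open_UNIV connected_UNIV UNIV_I _ UNIV_I] by blast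
    qed
  qed
  then show "\<Phi> x 0 = x" "integral_curve_on (\<Phi> x) UNIV" by (simp_all add: is_flow_iff)
qed

lemma flow_unique:
  assumes "integral_curve_on \<gamma> {a<..<b}" "0 \<in> {a<..<b}" "t \<in> {a<..<b}"
  shows "\<gamma> t = \<Phi> (\<gamma> 0) t"
proof (rule integral_curve_unique[OF assms(1) _ _ _ assms(2) _ assms(3)])
  show "integral_curve_on (\<Phi> (\<gamma> 0)) {a<..<b}"
    by (rule integral_curve_on_subset[OF flow_integral_curve]) simp
qed (simp_all add: flow_zero)

lemma flow_add: "\<Phi> (\<Phi> x s) t = \<Phi> x (s + t)"
proof -
  have "integral_curve_on (\<lambda>t. \<Phi> x (t + s)) UNIV"
    by (rule integral_curve_shift[OF flow_integral_curve]) simp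
  from integral_curve_unique[OF this flow_integral_curve[of "\<Phi> x s"] open_UNIV connected_UNIV UNIV_I,
      of 0 t]
  have "\<Phi> x (t + s) = \<Phi> (\<Phi> x s) t" by (simp add: flow_zero)
  then show ?thesis by (simp add: add.commute)
qed

text \<open>
  By uniqueness the global flow agrees with the local flows of the flow boxes, whose times have a
  common lower bound by compactness.
\<close>

lemma flow_isCont_small_time:
  obtains h where "h > 0" "\<And>y t. \<bar>t\<bar> < h \<Longrightarrow> isCont (\<lambda>p. \<Phi> (fst p) (snd p)) (y, t)"
proof -
  have "\<forall>x. \<exists>U h. open U \<and> x \<in> U \<and> h > 0 \<and>
      continuous_on (U \<times> {-h<..<h}) (\<lambda>p. \<Phi> (fst p) (snd p))"
  proof
    fix x
    obtain U h \<Psi> where box: "open U" "x \<in> U" "h > 0" "\<And>y. y \<in> U \<Longrightarrow> \<Psi> y 0 = y"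
      "\<And>y. y \<in> U \<Longrightarrow> integral_curve_on (\<Psi> y) {-h<..<h}"
      "continuous_on (U \<times> {-h<..<h}) (\<lambda>p. \<Psi> (fst p) (snd p))"
      by (rule flow_box[of x]) blast
    have "\<Psi> y t = \<Phi> y t" if "y \<in> U" "t \<in> {-h<..<h}" for y t
      using flow_unique[OF box(5)[OF that(1)] _ that(2)] box(3) box(4)[OF that(1)] by simp
    then have "continuous_on (U \<times> {-h<..<h}) (\<lambda>p. \<Phi> (fst p) (snd p))"
      by (intro continuous_on_eq[OF box(6)]) auto
    with box(1-3) show "\<exists>U h. open U \<and> x \<in> U \<and> h > 0 \<and>
        continuous_on (U \<times> {-h<..<h}) (\<lambda>p. \<Phi> (fst p) (snd p))" by blast
  qed
  then obtain U where "\<forall>x. \<exists>h. open (U x) \<and> x \<in> U x \<and> h > 0 \<and>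
      continuous_on (U x \<times> {-h<..<h}) (\<lambda>p. \<Phi> (fst p) (snd p))"
    by (rule choice[THEN exE])
  then obtain h where Uh: "\<forall>x. open (U x) \<and> x \<in> U x \<and> h x > (0::real) \<and>
      continuous_on (U x \<times> {-h x<..<h x}) (\<lambda>p. \<Phi> (fst p) (snd p))"
    by (rule choice[THEN exE])
  obtain D where D: "finite D" "UNIV \<subseteq> (\<Union>x\<in>D. U x)"
    by (rule compactE_image[OF compact_space, of UNIV U]) (use Uh in auto)
  have "D \<noteq> {}" using D(2) by auto
  show ?thesis
  proof (rule that[of "Min (h ` D)"])
    show "Min (h ` D) > 0" using D(1) \<open>D \<noteq> {}\<close> Uh by simp
    fix y t assume t: "\<bar>t\<bar> < Min (h ` D)"
    obtain x where x: "x \<in> D" "y \<in> U x" using D(2) by blast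
    have "Min (h ` D) \<le> h x" using D(1) x(1) by simp
    with t x have "(y, t) \<in> U x \<times> {-h x<..<h x}" by auto
    moreover have "open (U x \<times> {-h x<..<h x})" using Uh by (intro open_Times) simp_all
    ultimately show "isCont (\<lambda>p. \<Phi> (fst p) (snd p)) (y, t)"
      using Uh continuous_on_eq_continuous_at by blast
  qed
qed

text \<open>
  For small times this is the continuity of the local flows. Writing the time \<open>t\<close> map as the square
  of the time \<open>t / 2\<close> map doubles the range of admissible times.
\<close>

lemma continuous_flow: "continuous_on UNIV (\<lambda>(x, t). \<Phi> x t)"
proof -
  obtain h where h: "h > 0" "\<And>y t. \<bar>t\<bar> < h \<Longrightarrow> isCont (\<lambda>p. \<Phi> (fst p) (snd p)) (y, t)"
    by (rule flow_isCont_small_time) blast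
  have double: "isCont (\<lambda>p. \<Phi> (fst p) (snd p)) (y, t)" if "\<bar>t\<bar> < 2 ^ n * h" for n y t
    using that
  proof (induction n arbitrary: y t)
    case 0
    then show ?case using h(2) by simp
  next
    case (Suc n)
    have half: "\<bar>t / 2\<bar> < 2 ^ n * h" using Suc.prems by simp
    have "isCont (\<lambda>p. (fst p, snd p / 2)) (y, t)" by (intro continuous_intros) simp
    then have "isCont (\<lambda>p. \<Phi> (fst p) (snd p / 2)) (y, t)"
      using isCont_o2[of _ "\<lambda>p. (fst p, snd p / 2)" "\<lambda>p. \<Phi> (fst p) (snd p)"] Suc.IH[OF half, of y]
      by simp
    then have "isCont (\<lambda>p. (\<Phi> (fst p) (snd p / 2), snd p / 2)) (y, t)"
      by (intro continuous_intros) simp_all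
    then have "isCont (\<lambda>p. \<Phi> (\<Phi> (fst p) (snd p / 2)) (snd p / 2)) (y, t)"
      using isCont_o2[of _ "\<lambda>p. (\<Phi> (fst p) (snd p / 2), snd p / 2)" "\<lambda>p. \<Phi> (fst p) (snd p)"]
        Suc.IH[OF half, of "\<Phi> y (t / 2)"] by simp
    then show ?case by (simp add: flow_add)
  qed
  have "isCont (\<lambda>p. \<Phi> (fst p) (snd p)) p" for p
  proof -
    obtain n where "\<bar>snd p\<bar> / h < 2 ^ n" using real_arch_pow[of 2 "\<bar>snd p\<bar> / h"] by auto
    then have "\<bar>snd p\<bar> < 2 ^ n * h" using h(1) by (simp add: pos_divide_less_eq)
    from double[OF this, of "fst p"] show ?thesis by simp
  qed
  then show ?thesis by (simp add: continuous_on_eq_continuous_at split_def)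
qed

lemma continuous_f: "continuous_on UNIV f"
proof -
  have "isCont f p" for p
  proof -
    obtain c where c: "c \<in> A" "p \<in> fst c" by (rule chart_exists)
    have "isCont (local_f c) (snd c p)"
      using has_local_df[OF c(1), of "snd c p"] c(2) has_derivative_continuous by blast
    then have "isCont (\<lambda>q. local_f c (snd c q)) p"
      by (rule isCont_o2[OF isCont_chart[OF c]])
    moreover have "\<forall>\<^sub>F q in nhds p. local_f c (snd c q) = f q"
      using eventually_nhds_in_open[OF open_domain[OF c(1)] c(2)]
      by (rule eventually_mono) (simp add: chart_inv_chart[OF c(1)])
    ultimately show ?thesis by (simp add: isCont_cong)
  qed
  then show ?thesis by (simp add: continuous_on_eq_continuous_at)
qed

lemma f_flow_derivative:
  "((\<lambda>t. f (\<Phi> x t)) has_real_derivative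
     - g (\<Phi> x t) (gradient A g f (\<Phi> x t)) (gradient A g f (\<Phi> x t))) (at t)"
proof -
  let ?p = "\<Phi> x t"
  obtain c where c: "c \<in> A" "?p \<in> fst c" by (rule chart_exists)
  have "((snd c \<circ> \<Phi> x) has_derivative (\<lambda>h. h *\<^sub>R neg_gradient ?p c)) (at t)"
    using integral_curve_chart[OF flow_integral_curve UNIV_I c]
    by (simp add: has_vector_derivative_def local_neg_gradient_def chart_inv_chart[OF c])
  moreover have "(local_f c has_derivative local_df c (snd c ?p)) (at ((snd c \<circ> \<Phi> x) t))"
    using has_local_df[OF c(1), of "snd c ?p"] c(2) by simp
  ultimately have "(local_f c \<circ> (snd c \<circ> \<Phi> x) has_derivative
      local_df c (snd c ?p) \<circ> (\<lambda>h. h *\<^sub>R neg_gradient ?p c)) (at t)"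
    by (rule diff_chain_at)
  moreover have "local_df c (snd c ?p) \<circ> (\<lambda>h. h *\<^sub>R neg_gradient ?p c)
      = (\<lambda>h. - g ?p (gradient A g f ?p) (gradient A g f ?p) * h)"
  proof
    fix h
    have lin: "linear (local_df c (snd c ?p))" using linear_local_df[OF c(1), of "snd c ?p"] c(2) by blast
    have "local_df c (snd c ?p) (h *\<^sub>R neg_gradient ?p c) = - (h * local_df c (snd c ?p) (gradient A g f ?p c))"
      by (simp add: neg_gradient_def linear_cmul[OF lin] linear_neg[OF lin])
    also have "local_df c (snd c ?p) (gradient A g f ?p c) = g ?p (gradient A g f ?p) (gradient A g f ?p)"
      using metric_gradient[OF gradient_in_tangent_space] differential_chart[OF c gradient_in_tangent_space]
      by simp
    finally have eq: "local_df c (snd c ?p) (h *\<^sub>R neg_gradient ?p c)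
        = - (h * g ?p (gradient A g f ?p) (gradient A g f ?p))" .
    show "(local_df c (snd c ?p) \<circ> (\<lambda>h. h *\<^sub>R neg_gradient ?p c)) h
        = - g ?p (gradient A g f ?p) (gradient A g f ?p) * h"
      unfolding o_apply[of "local_df c (snd c ?p)"] eq by simp
  qed
  ultimately have "(local_f c \<circ> (snd c \<circ> \<Phi> x) has_derivative
      (\<lambda>h. - g ?p (gradient A g f ?p) (gradient A g f ?p) * h)) (at t)" by simp
  moreover have "\<forall>\<^sub>F s in at t. (local_f c \<circ> (snd c \<circ> \<Phi> x)) s = f (\<Phi> x s)"
  proof -
    have "\<forall>\<^sub>F s in nhds t. \<Phi> x s \<in> fst c"
      by (rule isCont_eventually_in_open[OF integral_curve_isCont[OF flow_integral_curve UNIV_I]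
            open_domain[OF c(1)] c(2)])
    then have "\<forall>\<^sub>F s in at t. \<Phi> x s \<in> fst c" by (simp add: eventually_nhds_conv_at)
    then show ?thesis by (rule eventually_mono) (simp add: chart_inv_chart[OF c(1)])
  qed
  ultimately show ?thesis
    unfolding has_field_derivative_def
    by (rule has_derivative_transform_eventually) (simp_all add: chart_inv_chart[OF c])
qed

lemma f_flow_decreasing:
  assumes "\<not> critical_point A f x" "0 < t"
  shows "f (\<Phi> x t) < f x"
proof -
  have "- g x (gradient A g f x) (gradient A g f x) < 0"
    using assms(1) critical_iff_metric_gradient[of x] metric_gradient_nonneg[of x] by simp
  then obtain d where d: "d > 0" "\<And>s. 0 < s \<Longrightarrow> s < d \<Longrightarrow> f (\<Phi> x (0 + s)) < f (\<Phi> x 0)"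
    using DERIV_neg_dec_right[OF f_flow_derivative[of x 0]] by (auto simp: flow_zero)
  define s where "s = min t (d / 2)"
  have s: "0 < s" "s < d" "s \<le> t" using d(1) assms(2) by (auto simp: s_def)
  have "f (\<Phi> x t) \<le> f (\<Phi> x s)"
    using s(3)
  proof (rule DERIV_nonpos_imp_nonincreasing)
    fix u
    show "\<exists>y. ((\<lambda>t. f (\<Phi> x t)) has_real_derivative y) (at u) \<and> y \<le> 0"
      using f_flow_derivative[of x u] metric_gradient_nonneg[of "\<Phi> x u"] by (intro exI conjI) auto
  qed
  also have "\<dots> < f x" using d(2)[OF s(1,2)] by (simp add: flow_zero)
  finally show ?thesis .
qed

lemma flow_critical:
  assumes "critical_point A f x"
  shows "\<Phi> x t = x"
proof -
  have neg_gradient: "neg_gradient x = (\<lambda>c. 0)"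
    using critical_imp_gradient_zero[OF assms] by (simp add: neg_gradient_def)
  have "integral_curve_on (\<lambda>t. x) UNIV"
    unfolding integral_curve_on_def has_velocity_def
    using neg_gradient_in_tangent_space[of x] by (simp add: neg_gradient o_def)
  from integral_curve_unique[OF flow_integral_curve this, of 0 x t] show ?thesis
    by (simp add: flow_zero)
qed

end

section \<open>Critical points of a Morse function are isolated\<close>

context riemannian_function
begin

lemma coord_hessian_linear_right:
  assumes "c \<in> A" "p \<in> fst c" and B: "finite B" "(\<Sum>b\<in>B. (w \<bullet> b) *\<^sub>R b) = w"
  shows "coord_hessian c f p v w = (\<Sum>b\<in>B. (w \<bullet> b) * coord_hessian c f p v b)"
    and "((\<lambda>y. local_df c y w) has_derivative (\<lambda>v. coord_hessian c f p v w)) (at (snd c p))"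
proof -
  have y: "snd c p \<in> chart_image c" using assms(2) by blast
  have der: "((\<lambda>y. local_df c y u) has_derivative (\<lambda>v. coord_hessian c f p v u)) (at (snd c p))" for u
  proof -
    have "Ck_on (Suc (Suc 0)) (local_f c) (chart_image c)"
      using smooth_local_f[OF assms(1)] unfolding smooth_on_def by blast
    then have "(\<lambda>y. local_df c y u) differentiable (at (snd c p))" using assms(2) by simp
    then show ?thesis unfolding coord_hessian_def by (simp add: frechet_derivative_works)
  qed
  then show "((\<lambda>y. local_df c y w) has_derivative (\<lambda>v. coord_hessian c f p v w)) (at (snd c p))" .
  have "((\<lambda>y. \<Sum>b\<in>B. (w \<bullet> b) * local_df c y b) has_derivative
      (\<lambda>v. \<Sum>b\<in>B. (w \<bullet> b) * coord_hessian c f p v b)) (at (snd c p))"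
    by (intro has_derivative_sum has_derivative_mult_right der)
  then have "((\<lambda>y. local_df c y w) has_derivative
      (\<lambda>v. \<Sum>b\<in>B. (w \<bullet> b) * coord_hessian c f p v b)) (at (snd c p))"
  proof (rule has_derivative_transform_within_open[OF _ open_image[OF assms(1)] y])
    fix z assume z: "z \<in> chart_image c"
    have lin: "linear (local_df c z)" using assms(1) z by (rule linear_local_df)
    have "local_df c z w = local_df c z (\<Sum>b\<in>B. (w \<bullet> b) *\<^sub>R b)" by (simp only: B(2))
    also have "\<dots> = (\<Sum>b\<in>B. (w \<bullet> b) * local_df c z b)"
      by (simp add: linear_sum[OF lin] linear_cmul[OF lin])
    finally show "(\<Sum>b\<in>B. (w \<bullet> b) * local_df c z b) = local_df c z w" by simp
  qed
  from fun_cong[OF has_derivative_unique[OF der this], of v]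
  show "coord_hessian c f p v w = (\<Sum>b\<in>B. (w \<bullet> b) * coord_hessian c f p v b)" .
qed

text \<open>
  In a chart the partial derivatives of \<open>f\<close> form a map \<open>P\<close> that vanishes at critical points. Its
  derivative at \<open>p\<close> is given by the Hessian and is therefore injective, so that \<open>P\<close> has no other
  zeros near \<open>p\<close>.
\<close>

lemma nondegenerate_imp_isolated:
  assumes "nondegenerate_critical_point A f p"
  shows "\<exists>U. open U \<and> U \<inter> {q. critical_point A f q} = {p}"
proof -
  have p: "critical_point A f p"
    using assms by (simp add: nondegenerate_critical_point_def)
  obtain c where c: "c \<in> A" "p \<in> fst c" by (rule chart_exists)
  have nondeg: "v = 0" if "\<And>w. coord_hessian c f p v w = 0" for v
    using assms c that unfolding nondegenerate_critical_point_def by blast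
  obtain B :: "'e set" where B: "finite B" "\<And>x. (\<Sum>b\<in>B. (x \<bullet> b) *\<^sub>R b) = x"
      "\<And>c k. k \<in> B \<Longrightarrow> (\<Sum>b\<in>B. c b *\<^sub>R b) \<bullet> k = c k"
    by (rule finite_coordinates) blast
  define P where "P y = (\<Sum>b\<in>B. local_df c y b *\<^sub>R b)" for y
  define H where "H v = (\<Sum>b\<in>B. coord_hessian c f p v b *\<^sub>R b)" for v
  have P_critical: "P (snd c q) = 0" if "critical_point A f q" "q \<in> fst c" for q
    by (simp add: P_def critical_imp_local_df[OF that(1) c(1) that(2)])
  have "(P has_derivative H) (at (snd c p))"
    unfolding P_def H_def
    by (intro has_derivative_sum has_derivative_scaleR_left coord_hessian_linear_right(2)[OF c B(1,2)])
  moreover have "P (snd c p) = 0" using p c(2) by (rule P_critical)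
  moreover have "v = 0" if "H v = 0" for v
  proof (rule nondeg)
    fix w
    have "coord_hessian c f p v b = 0" if "b \<in> B" for b
      using B(3)[OF that, of "coord_hessian c f p v"] \<open>H v = 0\<close> by (simp add: H_def)
    then show "coord_hessian c f p v w = 0"
      using coord_hessian_linear_right(1)[OF c B(1,2), of v w] by simp
  qed
  ultimately have "\<forall>\<^sub>F y in at (snd c p). P y \<noteq> 0" by (rule isolated_zero)
  then obtain W where W: "open W" "snd c p \<in> W" "\<And>y. y \<in> W \<Longrightarrow> y \<noteq> snd c p \<Longrightarrow> P y \<noteq> 0"
    unfolding eventually_at_topological by blast
  let ?U = "fst c \<inter> snd c -` W"
  have "q = p" if q: "q \<in> ?U" "critical_point A f q" for q
  proof -
    have "snd c q = snd c p" using W(3)[of "snd c q"] P_critical[OF q(2)] q(1) by blast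
    then show ?thesis
      using chart_inv_chart[OF c(1), of q] chart_inv_chart[OF c] q(1) by simp
  qed
  then have "?U \<inter> {q. critical_point A f q} = {p}" using p c(2) W(2) by blast
  moreover have "open ?U" using c(1) W(1) by (rule open_chart_preimage)
  ultimately show ?thesis by blast
qed

end

section \<open>Joining critical points by orbits\<close>

theorem theorem2p1:
  fixes A :: "('a::{t2_space, second_countable_topology}, 'e::finite_dim_inner) chart set"
    and g :: "'a \<Rightarrow> ('a, 'e) tvec \<Rightarrow> ('a, 'e) tvec \<Rightarrow> real"
    and f :: "'a \<Rightarrow> real"
    and p q :: 'a
  assumes "smooth_atlas A"
    and "riemannian_metric A g"
    and "connected (UNIV :: 'a set)"
    and "compact (UNIV :: 'a set)"
    and "morse_function A f"
    and "critical_point A f p"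
    and "critical_point A f q"
  shows "\<exists>(n::nat) (P :: nat \<Rightarrow> 'a). n \<ge> 1 \<and>
    (\<forall>i\<in>{1..n}. critical_point A f (P i)) \<and> P 1 = p \<and> P n = q \<and>
    (\<forall>i\<in>{1..n-1}. flows_to A g f (P i) (P (i + 1)) \<or> flows_to A g f (P (i + 1)) (P i))"
proof -
  let ?\<Phi> = "negative_gradient_flow A g f" and ?C = "{x. critical_point A f x}"
  have smooth: "smooth_function A f"
    and nondegenerate: "\<And>x. critical_point A f x \<Longrightarrow> nondegenerate_critical_point A f x"
    using assms(5) by (auto simp: morse_function_def)
  interpret compact_riemannian_function A g f
    using assms(1,2,4) smooth by unfold_locales
  interpret dynamics: gradient_like_flow ?\<Phi> f ?C
  proof
    show "compact (UNIV :: 'a set)" by (rule assms(4))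
    show "?\<Phi> x 0 = x" for x by (rule flow_zero)
    show "?\<Phi> (?\<Phi> x s) t = ?\<Phi> x (s + t)" for x s t by (rule flow_add)
    show "continuous_on UNIV (\<lambda>(x, t). ?\<Phi> x t)" by (rule continuous_flow)
    show "continuous_on UNIV f" by (rule continuous_f)
    show "?\<Phi> x t = x" if "x \<in> ?C" for x t using that by (simp add: flow_critical)
    show "f (?\<Phi> x t) < f x" if "x \<notin> ?C" "0 < t" for x t
      using that by (simp add: f_flow_decreasing)
    show "\<exists>U. open U \<and> U \<inter> ?C = {x}" if "x \<in> ?C" for x
      using that by (intro nondegenerate_imp_isolated nondegenerate) simp
  qed
  have flows: "dynamics.connects a b \<longleftrightarrow> flows_to A g f a b" for a b
    by (simp add: dynamics.connects_def flows_to_def)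
  have "dynamics.linked\<^sup>*\<^sup>* p q"
    using assms(3,6,7) by (intro dynamics.critical_points_linked) simp_all
  \<comment> \<open>a chain of \<open>m\<close> links has \<open>m + 1\<close> members; the index is shifted by one to start at \<open>1\<close>\<close>
  then obtain m where "(dynamics.linked ^^ m) p q" by (auto simp: rtranclp_power)
  then obtain P where P: "P 0 = p" "P m = q" "\<And>i. i < m \<Longrightarrow> dynamics.linked (P i) (P (Suc i))"
    unfolding relpowp_fun_conv by blast
  have critical: "critical_point A f (P i)" if "i \<le> m" for i
    using that P(2) P(3)[of i] assms(7)
    by (cases "i = m") (auto simp: dynamics.linked_def)
  show ?thesis
  proof (intro exI conjI ballI)
    show "1 \<le> Suc m" by simp
    show "critical_point A f (P (i - 1))" if "i \<in> {1..Suc m}" for i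
      using that by (intro critical) auto
    show "P (1 - 1) = p" "P (Suc m - 1) = q" using P by simp_all
    show "flows_to A g f (P (i - 1)) (P (i + 1 - 1)) \<or> flows_to A g f (P (i + 1 - 1)) (P (i - 1))"
      if i: "i \<in> {1..Suc m - 1}" for i
    proof -
      have "dynamics.linked (P (i - 1)) (P (Suc (i - 1)))" using i by (intro P(3)) auto
      then show ?thesis using i by (simp add: dynamics.linked_def flows)
    qed
  qed
qed

end
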